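(* Let $\sigma,\tau:\mathbb R_+\to\mathbb R$ satisfy $\sup_{x>0}\int_x^{x+1}\sigma(t)^2\,dt<\infty$ and $\sup_{x>0}\int_x^{x+1}|\tau(t)|\,dt<\infty$, and let $w:(0,\infty)\to(0,\infty)$ be measurable and obey $$\sup_{\{x,y>0:\ |x-y|\le1\}}\frac{w(y)}{w(x)}<\infty.$$ For any $E\in\mathbb R$ there exists a positive constant $C$ such that for any $l>1$ and any solution $u\in\mathfrak D$ of $\ell u=Eu$, one has $$\int_1^l w(x)\|\vec u(x)\|^2\,dx\le C\int_0^{l+1}w(x)|u(x)|^2\,dx.$$ In particular, if such a solution $u$ satisfies $\int_0^\infty w(x)|u(x)|^2\,dx<\infty$, then $$\int_0^\infty w(x)|u^{[1]}(x)|^2\,dx<\infty$$ and $$\lim_{x\to\infty}\sqrt{w(x)}\,|u(x)|=\lim_{x\to\infty}\sqrt{w(x)}\,|u^{[1]}(x)|=0.$$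
   Context: $\mathbb R_+=(0,\infty)$. For $u\in AC_{\mathrm{loc}}(\mathbb R_+)$ put $u^{[1]}:=u'-\sigma u$, let $\mathfrak D:=\{u\in AC_{\mathrm{loc}}(\mathbb R_+): u^{[1]}\in AC_{\mathrm{loc}}(\mathbb R_+)\}$ and, for $u\in\mathfrak D$, $\ell u:=-(u^{[1]})'-\sigma u^{[1]}+(\tau-\sigma^2)u$. For $u\in\mathfrak D$, $\vec u(x):=(u^{[1]}(x),u(x))^\top$ and $\|\vec u(x)\|^2:=|u^{[1]}(x)|^2+|u(x)|^2$. *)

theory Defs
  imports "HOL-Analysis.Analysis"
begin

text \<open>
  Functions on the half-line $(0,\infty)$ are total functions on the reals whose values outside
  \<open>{0<..}\<close> are never inspected. Solutions are complex-valued.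
\<close>

text \<open>
  The usual \<open>\<epsilon>\<close>-\<open>\<delta>\<close> definition. The members of a division are nonempty compact intervals with
  pairwise disjoint interiors, so \<open>\<D>\<close> ranges over all finite families of nonoverlapping
  intervals \<open>{Inf K..Sup K}\<close> contained in \<open>{a..b}\<close>.
\<close>
definition abs_cont_on :: "real \<Rightarrow> real \<Rightarrow> (real \<Rightarrow> complex) \<Rightarrow> bool" where
  "abs_cont_on a b f \<longleftrightarrow>
    (\<forall>\<epsilon>>0. \<exists>\<delta>>0. \<forall>\<D> T. \<D> division_of T \<and> T \<subseteq> {a..b} \<and> (\<Sum>K\<in>\<D>. Sup K - Inf K) < \<delta> \<longrightarrow>
      (\<Sum>K\<in>\<D>. norm (f (Sup K) - f (Inf K))) < \<epsilon>)"

definition AC_loc :: "(real \<Rightarrow> complex) set" where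
  "AC_loc = {f. \<forall>a b. 0 < a \<and> a \<le> b \<longrightarrow> abs_cont_on a b f}"

text \<open>
  \<open>f' = g\<close> almost everywhere on $(0,\infty)$. Every \<open>f \<in> AC_loc\<close> has such a \<open>g\<close>, unique up to
  null sets, by Lebesgue's theorem.
\<close>
definition has_ae_deriv :: "(real \<Rightarrow> complex) \<Rightarrow> (real \<Rightarrow> complex) \<Rightarrow> bool" where
  "has_ae_deriv f g \<longleftrightarrow> (AE x in lebesgue_on {0<..}. (f has_vector_derivative g x) (at x))"

text \<open>
  The expression \<open>u' - \<sigma> u\<close> is an almost-everywhere class; \<open>v\<close> is a locally absolutely continuous
  representative of it. By continuity there is at most one on $(0,\infty)$, so the choice in
  \<open>quasi_deriv\<close> is immaterial there.
\<close>
definition is_quasi_deriv :: "(real \<Rightarrow> real) \<Rightarrow> (real \<Rightarrow> complex) \<Rightarrow> (real \<Rightarrow> complex) \<Rightarrow> bool" where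
  "is_quasi_deriv \<sigma> u v \<longleftrightarrow> v \<in> AC_loc \<and>
    (\<exists>u'. has_ae_deriv u u' \<and>
      (AE x in lebesgue_on {0<..}. v x = u' x - of_real (\<sigma> x) * u x))"

definition quasi_deriv :: "(real \<Rightarrow> real) \<Rightarrow> (real \<Rightarrow> complex) \<Rightarrow> real \<Rightarrow> complex" where
  "quasi_deriv \<sigma> u = (SOME v. is_quasi_deriv \<sigma> u v)"

definition quasi_domain :: "(real \<Rightarrow> real) \<Rightarrow> (real \<Rightarrow> complex) set" where
  "quasi_domain \<sigma> = {u \<in> AC_loc. \<exists>v. is_quasi_deriv \<sigma> u v}"

text \<open>
  \<open>\<ell> u\<close> is likewise an almost-everywhere class: \<open>ell_eq \<sigma> \<tau> u f\<close> says \<open>\<ell> u = f\<close> almost everywhere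
  on $(0,\infty)$.
\<close>
definition ell_eq ::
    "(real \<Rightarrow> real) \<Rightarrow> (real \<Rightarrow> real) \<Rightarrow> (real \<Rightarrow> complex) \<Rightarrow> (real \<Rightarrow> complex) \<Rightarrow> bool" where
  "ell_eq \<sigma> \<tau> u f \<longleftrightarrow>
    (\<exists>v'. has_ae_deriv (quasi_deriv \<sigma> u) v' \<and>
      (AE x in lebesgue_on {0<..}.
        - v' x - of_real (\<sigma> x) * quasi_deriv \<sigma> u x + of_real (\<tau> x - (\<sigma> x)\<^sup>2) * u x = f x))"

definition solutions :: "(real \<Rightarrow> real) \<Rightarrow> (real \<Rightarrow> real) \<Rightarrow> real \<Rightarrow> (real \<Rightarrow> complex) set" where
  "solutions \<sigma> \<tau> E = {u \<in> quasi_domain \<sigma>. ell_eq \<sigma> \<tau> u (\<lambda>x. of_real E * u x)}"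

text \<open>The product norm on pairs is the Euclidean one.\<close>
definition sol_vec :: "(real \<Rightarrow> real) \<Rightarrow> (real \<Rightarrow> complex) \<Rightarrow> real \<Rightarrow> complex \<times> complex" where
  "sol_vec \<sigma> u x = (quasi_deriv \<sigma> u x, u x)"

end

theory Submission
  imports Defs
begin

text \<open>
  With \<open>v = u\<^bsup>[1]\<^esup>\<close> and \<open>q = \<tau> - \<sigma>\<^sup>2 - E\<close> the equation is the system \<open>u' = v + \<sigma> u\<close>,
  \<open>v' = q u - \<sigma> v\<close>, whose coefficients have integrals over unit intervals bounded by a single constant.
  By Gronwall's inequality the values of \<open>\<bar>u\<bar> + \<bar>v\<bar>\<close> on a unit interval are all comparable to their
  maximum \<open>Y\<close>. Somewhere on the interval \<open>\<bar>u\<bar> \<ge> \<eta> Y\<close> for a fixed \<open>\<eta>\<close>: otherwise \<open>v\<close> would be large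
  and nearly constant on a short interval and drive \<open>u\<close> away from zero. As \<open>\<sigma>\<close> is uniformly locally
  square integrable, \<open>u\<close> is equicontinuous relative to \<open>Y\<close>, so it stays of size \<open>\<eta> Y / 2\<close> on an interval
  of fixed length, and \<open>Y\<^sup>2\<close> is bounded by a constant times the integral of \<open>\<bar>u\<bar>\<^sup>2\<close>. The weight varies by
  at most a constant factor on unit intervals, and summation over such intervals gives the claims.
\<close>

subsection \<open>The fundamental theorem of calculus for absolutely continuous functions\<close>

text \<open>Distinct tags sharing a cell would force that cell to have empty interior, that is, to
  be a single point, and then the tags agree. Sums over tagged cells can therefore be reindexed by
  the cells alone, as absolute continuity requires.\<close>

lemma inj_on_snd_tagged_partial_division:
  fixes p :: "(real \<times> real set) set"
  assumes "p tagged_partial_division_of i"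
  shows "inj_on snd p"
proof (rule inj_onI)
  fix A B assume AB: "A \<in> p" "B \<in> p" "snd A = snd B"
  obtain x y K where eq: "A = (x, K)" "B = (y, K)"
    using AB(3) by (metis prod.collapse)
  note D = tagged_partial_division_ofD[OF assms]
  obtain c d where K: "K = cbox c d" using D(4) AB eq by blast
  have "x \<in> K" "y \<in> K" using D(2) AB eq by blast+
  show "A = B"
  proof (rule ccontr)
    assume "A \<noteq> B"
    then have "x \<noteq> y" "interior K = {}" using D(5)[of x K y K] AB eq by auto
    with \<open>x \<in> K\<close> \<open>y \<in> K\<close> show False
      by (auto simp: K interior_cbox box_real)
  qed
qed

text \<open>Each length is a Lebesgue measure and two cells meet at most in a null set, so the
  lengths add up to the measure of the union. This turns an open set of small measure into the small
  total length asked for by absolute continuity.\<close>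

lemma sum_lengths_tagged_partial_division:
  fixes p :: "(real \<times> real set) set"
  assumes p: "p tagged_partial_division_of i" and G: "\<Union>(snd ` p) \<subseteq> G" "G \<in> lmeasurable"
  shows "(\<Sum>K\<in>snd ` p. Sup K - Inf K) \<le> measure lebesgue G"
proof -
  note D = tagged_partial_division_ofD[OF p]
  have iv: "\<exists>c d. c \<le> d \<and> K = {c..d}" if "K \<in> snd ` p" for K
    using that D(2,4) by (metis (no_types, lifting) atLeastatMost_empty_iff box_real(2) empty_iff imageE prod.collapse)
  have "(\<Sum>K\<in>snd ` p. Sup K - Inf K) = (\<Sum>K\<in>snd ` p. measure lebesgue K)"
    by (rule sum.cong) (use iv in fastforce)+
  also have "\<dots> = measure lebesgue (\<Union>(snd ` p))"
  proof (rule measure_negligible_finite_Union[symmetric])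
    show "finite (snd ` p)" using D(1) by blast
    show "K \<in> lmeasurable" if "K \<in> snd ` p" for K
      using iv[OF that] by auto
    show "pairwise (\<lambda>S T. negligible (S \<inter> T)) (snd ` p)"
    proof (rule pairwiseI)
      fix S T assume ST: "S \<in> snd ` p" "T \<in> snd ` p" "S \<noteq> T"
      then have disj: "interior S \<inter> interior T = {}"
        using D(5) by (metis (no_types, lifting) imageE prod.collapse snd_conv)
      obtain c d c' d' where cd: "S = {c..d}" "T = {c'..d'}" using iv ST by meson
      have "S \<inter> T = {max c c'..min d d'}" using cd by auto
      moreover have "{max c c'<..<min d d'} = {}"
        using disj cd by (auto simp: interior_atLeastAtMost_real)
      ultimately show "negligible (S \<inter> T)"
        by (metis box_real(1,2) negligible_interval(1))
    qed
  qed
  also have "\<dots> \<le> measure lebesgue G"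
    by (rule measure_mono_fmeasurable[OF G(1) _ G(2)])
      (use D(1) iv in \<open>auto intro!: sets.finite_Union, metis box_real(2) lmeasurable_cbox fmeasurableD imageI snd_conv\<close>)
  finally show ?thesis .
qed

text \<open>Integrability of \<open>g\<close> is part of the conclusion: the increment of
  \<open>f\<close> telescopes over the cells of a tagged division and is compared with the Riemann
  sum cell by cell.\<close>

lemma abs_cont_on_has_integral:
  assumes ac: "abs_cont_on a b f" and "a \<le> b" and N: "negligible N"
    and der: "\<And>x. x \<in> {a..b} - N \<Longrightarrow> (f has_vector_derivative g x) (at x)"
  shows "(g has_integral (f b - f a)) {a..b}"
proof (cases "a = b")
  case True
  then show ?thesis by auto
next
  case False
  with \<open>a \<le> b\<close> have "a < b" by simp
  \<comment> \<open>With the value 0 on \<open>N\<close>, a cell tagged in \<open>N\<close>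
    contributes only the increment of \<open>f\<close>. The null set is restored at the end by a
    spike argument.\<close>
  define g0 where "g0 x = (if x \<in> N then 0 else g x)" for x
  have "(g0 has_integral (f b - f a)) {a..b}"
    unfolding has_integral_factor_content_real
  proof (intro allI impI)
    fix e :: real assume e: "e > 0"
    \<comment> \<open>Half of the admissible error \<open>e * (b - a)\<close>: one half goes to the
      cells tagged in \<open>N\<close>, the other to the remaining cells.\<close>
    define e' where "e' = e * (b - a) / 2"
    have "e' > 0" using e \<open>a < b\<close> by (simp add: e'_def)
    then obtain \<delta> where "\<delta> > 0" and \<delta>: "\<And>D T. D division_of T \<Longrightarrow> T \<subseteq> {a..b} \<Longrightarrow>
        (\<Sum>K\<in>D. Sup K - Inf K) < \<delta> \<Longrightarrow> (\<Sum>K\<in>D. norm (f (Sup K) - f (Inf K))) < e'"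
      using ac unfolding abs_cont_on_def by meson
    have "N \<in> sets lebesgue" using N by (simp add: negligible_imp_sets)
    then obtain G where G: "open G" "N \<subseteq> G" "G - N \<in> lmeasurable" "emeasure lebesgue (G - N) < ennreal \<delta>"
      using sets_lebesgue_outer_open \<open>\<delta> > 0\<close> by metis
    \<comment> \<open>Outer regularity controls only \<open>G - N\<close>; since \<open>N\<close> is
      null, \<open>G\<close> itself is measurable with the same measure.\<close>
    have GN: "G = (G - N) \<union> N" using G by blast
    have Gm: "G \<in> lmeasurable"
      by (subst GN) (intro fmeasurable.Un G(3) negligible_imp_measurable N)
    have "measure lebesgue G = measure lebesgue (G - N)"
      using Gm N by (simp add: measure_Diff_null_set negligible_iff_null_sets)
    also have "\<dots> < \<delta>"
      using G(3,4) \<open>\<delta> > 0\<close> by (simp add: emeasure_eq_measure2 ennreal_less_iff)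
    finally have G\<delta>: "measure lebesgue G < \<delta>" .
    have "\<forall>x. \<exists>d>0. x \<in> {a..b} - N \<longrightarrow>
         (\<forall>y. norm (y-x) < d \<longrightarrow> norm (f y - f x - (y-x) *\<^sub>R g x) \<le> e/2 * norm (y-x))"
      using der[unfolded has_vector_derivative_def has_derivative_at_alt] e
      by (metis half_gt_zero zero_less_one)
    then obtain d where d: "\<And>x. 0 < d x"
      "\<And>x y. \<lbrakk>x \<in> {a..b} - N; norm (y-x) < d x\<rbrakk> \<Longrightarrow> norm (f y - f x - (y-x) *\<^sub>R g x) \<le> e/2 * norm (y-x)"
      by metis
    \<comment> \<open>Cells tagged in the exceptional set \<open>N\<close> are forced into an open set \<open>G\<close> of measure below
      \<open>\<delta>\<close>, so absolute continuity bounds their increments; on the others \<open>f\<close> is differentiable at the tag.\<close>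
    define \<gamma> where "\<gamma> x = (if x \<in> N then G else ball x (d x))" for x
    have gauge: "gauge \<gamma>"
      using G(1,2) d(1) by (auto simp: gauge_def \<gamma>_def)
    have bound: "norm ((\<Sum>(x, k)\<in>p. measure lborel k *\<^sub>R g0 x) - (f b - f a)) \<le> e * measure lborel {a..b}"
      if p: "p tagged_division_of {a..b}" and fine: "\<gamma> fine p" for p
    proof -
      note D = tagged_division_ofD[OF p]
      have pp: "p tagged_partial_division_of {a..b}" using p by (simp add: tagged_division_of_def)
      define q where "q = {z\<in>p. fst z \<in> N}"
      have qp: "q tagged_partial_division_of {a..b}" "q \<subseteq> p"
        using tagged_partial_division_subset[OF pp] by (auto simp: q_def)
      have iv: "\<exists>u v. u \<le> v \<and> K = {u..v}" if "(x, K) \<in> p" for x K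
        using that D(2,4) by (metis atLeastatMost_empty_iff box_real(2) empty_iff)
      have ba: "b - a = (\<Sum>(x,K)\<in>p. Sup K - Inf K)" "f b - f a = (\<Sum>(x,K)\<in>p. f(Sup K) - f(Inf K))"
        using additive_tagged_division_1[OF \<open>a \<le> b\<close> p, where f= "\<lambda>x. x"]
          additive_tagged_division_1[OF \<open>a \<le> b\<close> p, where f= f] by auto
      define h where "h z = (case z of (x,K) \<Rightarrow> measure lborel K *\<^sub>R g0 x - (f(Sup K) - f(Inf K)))" for z
      have "(\<Sum>(x, k)\<in>p. measure lborel k *\<^sub>R g0 x) - (f b - f a) = sum h p"
        unfolding ba(2) sum_subtractf[symmetric] h_def by (rule sum.cong) auto
      also have "\<dots> = sum h q + sum h (p - q)"
        using D(1) qp(2) by (metis add.commute sum.subset_diff)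
      finally have split: "(\<Sum>(x, k)\<in>p. measure lborel k *\<^sub>R g0 x) - (f b - f a) = sum h q + sum h (p - q)" .
      have "norm (sum h q) \<le> (\<Sum>z\<in>q. norm (f (Sup (snd z)) - f (Inf (snd z))))"
        by (rule sum_norm_le) (auto simp: h_def q_def g0_def norm_minus_commute)
      also have "\<dots> = (\<Sum>K\<in>snd ` q. norm (f (Sup K) - f (Inf K)))"
        by (simp add: sum.reindex[OF inj_on_snd_tagged_partial_division[OF qp(1)]])
      also have "\<dots> < e'"
      proof (rule \<delta>)
        show "snd ` q division_of \<Union>(snd ` q)"
          using partial_division_of_tagged_division[OF qp(1)] .
        show "\<Union>(snd ` q) \<subseteq> {a..b}"
          using qp(2) D(3) by fastforce
        have "\<Union>(snd ` q) \<subseteq> G"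
        proof (rule Union_least)
          fix K assume "K \<in> snd ` q"
          then obtain x where "(x, K) \<in> p" "x \<in> N" by (auto simp: q_def)
          then show "K \<subseteq> G" using fineD[OF fine, of x K] by (simp add: \<gamma>_def)
        qed
        then show "(\<Sum>K\<in>snd ` q. Sup K - Inf K) < \<delta>"
          using sum_lengths_tagged_partial_division[OF qp(1) _ Gm] G\<delta> by linarith
      qed
      finally have 1: "norm (sum h q) < e'" .
      have "norm (sum h (p - q)) \<le> (\<Sum>(x,K)\<in>p - q. e/2 * (Sup K - Inf K))"
      proof (rule sum_norm_le, clarify)
        fix x K assume xK: "(x, K) \<in> p" "(x, K) \<notin> q"
        then have xN: "x \<notin> N" by (simp add: q_def)
        obtain u v where k: "K = {u..v}" "u \<le> v" using iv[OF xK(1)] by auto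
        have xk: "x \<in> K" "K \<subseteq> {a..b}" using D xK by auto
        have ball: "K \<subseteq> ball x (d x)"
          using fine xK(1) xN by (force simp: fine_def \<gamma>_def)
        then have "u \<in> ball x (d x)" "v \<in> ball x (d x)" using k by auto
        then have nb: "norm (u - x) < d x" "norm (v - x) < d x" by (auto simp: dist_real_def)
        have xab: "x \<in> {a..b} - N" using xk xN by auto
        \<comment> \<open>Straddle estimate: the tag lies between the endpoints, so the distances
          from \<open>x\<close> to \<open>u\<close> and \<open>v\<close> add up to the length of the
          cell.\<close>
        have "norm ((v - u) *\<^sub>R g x - (f v - f u)) = norm (f u - f x - (u - x) *\<^sub>R g x - (f v - f x - (v - x) *\<^sub>R g x))"
          by (auto simp: algebra_simps)
        also have "\<dots> \<le> norm (f u - f x - (u - x) *\<^sub>R g x) + norm (f v - f x - (v - x) *\<^sub>R g x)"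
          by (rule norm_triangle_ineq4)
        also have "\<dots> \<le> e/2 * norm (u - x) + e/2 * norm (v - x)"
          by (intro add_mono d xab nb)
        also have "\<dots> = e/2 * (Sup K - Inf K)"
          using xk k by (auto simp: field_simps)
        finally show "norm (h (x, K)) \<le> e/2 * (Sup K - Inf K)"
          using k xN by (simp add: h_def g0_def)
      qed
      also have "\<dots> \<le> (\<Sum>(x,K)\<in>p. e/2 * (Sup K - Inf K))"
      proof (rule sum_mono2)
        show "0 \<le> (case z of (x, K) \<Rightarrow> e/2 * (Sup K - Inf K))" if "z \<in> p - (p - q)" for z
        proof -
          obtain x K where z: "z = (x, K)" by fastforce
          then obtain u v where "K = {u..v}" "u \<le> v" using iv[of x K] \<open>z \<in> p - (p - q)\<close> by auto
          with e z show ?thesis by auto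
        qed
      qed (use D(1) in auto)
      also have "\<dots> = e'"
        by (simp add: e'_def ba(1) split_def sum_distrib_left sum_divide_distrib)
      finally have 2: "norm (sum h (p - q)) \<le> e'" .
      have "norm (sum h q + sum h (p - q)) \<le> e' + e'"
        using norm_triangle_ineq[of "sum h q" "sum h (p - q)"] 1 2 by linarith
      also have "\<dots> = e * measure lborel {a..b}" using \<open>a \<le> b\<close> by (simp add: e'_def)
      finally show ?thesis using split by simp
    qed
    show "\<exists>d. gauge d \<and> (\<forall>p. p tagged_division_of {a..b} \<and> d fine p \<longrightarrow>
        norm ((\<Sum>(x, k)\<in>p. measure lborel k *\<^sub>R g0 x) - (f b - f a)) \<le> e * measure lborel {a..b})"
      by (intro exI[of _ \<gamma>] conjI allI impI gauge bound) (erule conjunct1, erule conjunct2)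
  qed
  then show ?thesis
    by (rule has_integral_spike[OF N, rotated]) (auto simp: g0_def)
qed

text \<open>Absolute continuity is applied to divisions consisting of one interval.\<close>

lemma abs_cont_on_imp_continuous_on:
  assumes "abs_cont_on a b f"
  shows "continuous_on {a..b} f"
  unfolding continuous_on_iff
proof (intro ballI allI impI)
  fix x and e :: real assume x: "x \<in> {a..b}" and "e > 0"
  then obtain \<delta> where "\<delta> > 0" and \<delta>: "\<And>D T. D division_of T \<Longrightarrow> T \<subseteq> {a..b} \<Longrightarrow>
        (\<Sum>K\<in>D. Sup K - Inf K) < \<delta> \<Longrightarrow> (\<Sum>K\<in>D. norm (f (Sup K) - f (Inf K))) < e"
    using assms unfolding abs_cont_on_def by meson
  have *: "norm (f t - f s) < e" if "s \<in> {a..b}" "t \<in> {a..b}" "s \<le> t" "t - s < \<delta>" for s t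
    using \<delta>[of "{{s..t}}" "{s..t}"] division_of_self[of s t] that by auto
  show "\<exists>d>0. \<forall>x'\<in>{a..b}. dist x' x < d \<longrightarrow> dist (f x') (f x) < e"
  proof (intro exI[of _ \<delta>] conjI ballI impI)
    fix x' assume "x' \<in> {a..b}" "dist x' x < \<delta>"
    then show "dist (f x') (f x) < e"
      using *[of x x'] *[of x' x] x
      by (cases "x \<le> x'") (auto simp: dist_norm norm_minus_commute)
  qed fact
qed

subsection \<open>A local bound for first-order systems\<close>

text \<open>At a maximum point \<open>m\<close> the oscillation is at most \<open>f m / 2\<close>,
  so no value of \<open>f\<close> falls below half the maximum. The assumption \<open>step\<close>
  uses only an upper bound for \<open>f\<close> on the interval, which avoids integrating the
  product of \<open>A\<close> and \<open>f\<close>.\<close>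

lemma gronwall_half:
  fixes A f :: "real \<Rightarrow> real"
  assumes cont: "continuous_on {a..b} f" and A: "A integrable_on {a..b}" "\<And>x. x \<in> {a..b} \<Longrightarrow> 0 \<le> A x"
    and f: "\<And>x. x \<in> {a..b} \<Longrightarrow> 0 \<le> f x"
    and step: "\<And>s t B. a \<le> s \<Longrightarrow> s \<le> t \<Longrightarrow> t \<le> b \<Longrightarrow> (\<And>x. x \<in> {s..t} \<Longrightarrow> f x \<le> B) \<Longrightarrow>
        \<bar>f t - f s\<bar> \<le> B * integral {s..t} A"
    and half: "integral {a..b} A \<le> 1/2" and pq: "p \<in> {a..b}" "q \<in> {a..b}"
  shows "f p \<le> 2 * f q"
proof -
  obtain m where m: "m \<in> {a..b}" "\<And>x. x \<in> {a..b} \<Longrightarrow> f x \<le> f m"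
    using continuous_attains_sup[of "{a..b}" f] cont pq by auto
  have *: "\<bar>f t - f s\<bar> \<le> f m * (1/2)" if "a \<le> s" "s \<le> t" "t \<le> b" for s t
  proof -
    have "\<bar>f t - f s\<bar> \<le> f m * integral {s..t} A"
      using that m by (intro step) auto
    also have "integral {s..t} A \<le> integral {a..b} A"
      using that A by (intro integral_subset_le integrable_on_subinterval[OF A(1)]) auto
    then have "f m * integral {s..t} A \<le> f m * (1/2)"
      using half f[OF m(1)] by (intro mult_left_mono) auto
    finally show ?thesis .
  qed
  have "\<bar>f m - f q\<bar> \<le> f m * (1/2)"
    using *[of m q] *[of q m] m(1) pq by (cases "q \<le> m") (auto simp: abs_minus_commute)
  then show ?thesis using m(2)[OF pq(1)] by linarith
qed

text \<open>Each piece of the interval on which \<open>A\<close> has integral at most 1/2 costs a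
  factor 2; the induction splits off one such piece at the right end.\<close>

lemma gronwall_power:
  fixes A f :: "real \<Rightarrow> real"
  assumes cont: "continuous_on {a..b} f" and A: "A integrable_on {a..b}" "\<And>x. x \<in> {a..b} \<Longrightarrow> 0 \<le> A x"
    and f: "\<And>x. x \<in> {a..b} \<Longrightarrow> 0 \<le> f x"
    and step: "\<And>s t B. a \<le> s \<Longrightarrow> s \<le> t \<Longrightarrow> t \<le> b \<Longrightarrow> (\<And>x. x \<in> {s..t} \<Longrightarrow> f x \<le> B) \<Longrightarrow>
        \<bar>f t - f s\<bar> \<le> B * integral {s..t} A"
    and "integral {a..b} A \<le> n / 2" and "p \<in> {a..b}" "q \<in> {a..b}"
  shows "f p \<le> 2 ^ n * f q"
  using assms
proof (induction n arbitrary: b p q)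
  case 0
  \<comment> \<open>With nonpositive total integral of \<open>A\<close>, all increments vanish and
    \<open>f\<close> is constant.\<close>
  have "\<bar>f t - f s\<bar> \<le> 0" if st: "a \<le> s" "s \<le> t" "t \<le> b" for s t
  proof -
    have "continuous_on {s..t} f" using continuous_on_subset[OF "0.prems"(1)] st by auto
    then obtain m where m: "m \<in> {s..t}" "\<And>x. x \<in> {s..t} \<Longrightarrow> f x \<le> f m"
      using continuous_attains_sup[of "{s..t}" f] st by auto
    have "\<bar>f t - f s\<bar> \<le> f m * integral {s..t} A"
      using that m by (intro "0.prems") auto
    also have "integral {s..t} A \<le> integral {a..b} A"
      using that 0 by (intro integral_subset_le integrable_on_subinterval[OF "0.prems"(2)]) auto
    then have "f m * integral {s..t} A \<le> f m * 0"
      using 0 m st by (intro mult_left_mono "0.prems") auto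
    finally show ?thesis by simp
  qed
  from this[of p q] this[of q p] 0 show ?case by (cases "p \<le> q") auto
next
  case (Suc n)
  note cont = Suc.prems(1) and A = Suc.prems(2,3) and f = Suc.prems(4) and step = Suc.prems(5)
  show ?case
  proof (cases "integral {a..b} A \<le> n / 2")
    case True
    have "f p \<le> 2 ^ n * f q"
      by (rule Suc.IH[OF cont A f step True Suc.prems(7,8)])
    moreover have "0 \<le> 2 ^ n * f q" using f Suc.prems(8) by simp
    ultimately show ?thesis by simp
  next
    case False
    have ab: "a \<le> b" using Suc.prems by auto
    \<comment> \<open>The cut point \<open>m\<close> comes from the intermediate value theorem:
      exactly \<open>n / 2\<close> of the integral lies to its left, hence at most 1/2 to its
      right.\<close>
    have "continuous_on {a..b} (\<lambda>x. integral {a..x} A)"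
      using A(1) by (rule indefinite_integral_continuous_1)
    moreover have "integral {a..a} A \<le> n/2" by simp
    ultimately obtain m where m: "a \<le> m" "m \<le> b" "integral {a..m} A = n/2"
      using IVT'[of "\<lambda>x. integral {a..x} A" a "n/2" b] False ab by auto
    have sum: "integral {a..m} A + integral {m..b} A = integral {a..b} A"
      using m A(1) by (intro Henstock_Kurzweil_Integration.integral_combine) auto
    have left: "f x \<le> 2^n * f y" if "x \<in> {a..m}" "y \<in> {a..m}" for x y
    proof (rule Suc.IH[of m])
      show "continuous_on {a..m} f" using cont by (rule continuous_on_subset) (use m in auto)
      show "A integrable_on {a..m}" using A(1) by (rule integrable_on_subinterval) (use m in auto)
    qed (use m A f step that in auto)
    have right: "f x \<le> 2 * f y" if "x \<in> {m..b}" "y \<in> {m..b}" for x y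
    proof (rule gronwall_half[of m b f A])
      show "continuous_on {m..b} f" using cont by (rule continuous_on_subset) (use m in auto)
      show "A integrable_on {m..b}" using A(1) by (rule integrable_on_subinterval) (use m in auto)
      show "integral {m..b} A \<le> 1/2" using sum m(3) Suc.prems(6) by (simp add: field_simps)
    qed (use m A f step that in auto)
    have pow: "1 \<le> (2::real)^n" by simp
    consider "p \<le> m" "q \<le> m" | "p \<le> m" "m \<le> q" | "m \<le> p" "q \<le> m" | "m \<le> p" "m \<le> q" by linarith
    then show ?thesis
    proof cases
      case 1
      then have "f p \<le> 2^n * f q" "0 \<le> 2 ^ n * f q" using left f Suc.prems by auto
      then show ?thesis by simp
    next
      case 2
      then have "f p \<le> 2^n * f m" "f m \<le> 2 * f q" using left right m Suc.prems by auto
      then have "f p \<le> 2^n * (2 * f q)"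
        using mult_left_mono[of "f m" "2 * f q" "2^n"] pow by linarith
      then show ?thesis by simp
    next
      case 3
      then have "f p \<le> 2 * f m" "f m \<le> 2^n * f q" using left right m Suc.prems by auto
      then show ?thesis by simp
    next
      case 4
      then have "f p \<le> 2 * f q" "0 \<le> f q" using right f Suc.prems by auto
      moreover have "1 * f q \<le> 2^n * f q" using pow \<open>0 \<le> f q\<close> by (intro mult_right_mono)
      ultimately show ?thesis by simp
    qed
  qed
qed

text \<open>The equation in integrated form, with \<open>v\<close> in the role of the
  quasi-derivative and \<open>q\<close> in that of \<open>\<tau> - \<sigma>\<^sup>2 - E\<close>. One
  \<open>M\<close> bounds both coefficient integrals, so constants obtained from \<open>M\<close>
  alone do not depend on the position \<open>a\<close>.\<close>

locale first_order_system =
  fixes a M :: real and \<sigma> q :: "real \<Rightarrow> real" and u v :: "real \<Rightarrow> complex"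
  assumes M: "1 \<le> M"
    and cont: "continuous_on {a..a+1} u" "continuous_on {a..a+1} v"
    and \<sigma>_int: "(\<lambda>x. \<bar>\<sigma> x\<bar>) integrable_on {a..a+1}"
    and \<sigma>2_int: "(\<lambda>x. (\<sigma> x)\<^sup>2) integrable_on {a..a+1}" "integral {a..a+1} (\<lambda>x. (\<sigma> x)\<^sup>2) \<le> M"
    and q_int: "(\<lambda>x. \<bar>q x\<bar>) integrable_on {a..a+1}" "integral {a..a+1} (\<lambda>x. \<bar>q x\<bar>) \<le> M"
    and u_int: "\<And>s t. a \<le> s \<Longrightarrow> s \<le> t \<Longrightarrow> t \<le> a+1 \<Longrightarrow>
        ((\<lambda>x. v x + of_real (\<sigma> x) * u x) has_integral (u t - u s)) {s..t}"
    and v_int: "\<And>s t. a \<le> s \<Longrightarrow> s \<le> t \<Longrightarrow> t \<le> a+1 \<Longrightarrow>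
        ((\<lambda>x. of_real (q x) * u x - of_real (\<sigma> x) * v x) has_integral (v t - v s)) {s..t}"
begin

lemma coeffs_integrable_on:
  assumes "a \<le> s" "t \<le> a+1"
  shows "(\<lambda>x. \<bar>\<sigma> x\<bar>) integrable_on {s..t}" "(\<lambda>x. (\<sigma> x)\<^sup>2) integrable_on {s..t}"
    "(\<lambda>x. \<bar>q x\<bar>) integrable_on {s..t}"
  using integrable_on_subinterval[OF \<sigma>_int, of s t] integrable_on_subinterval[OF \<sigma>2_int(1), of s t]
    integrable_on_subinterval[OF q_int(1), of s t] assms by auto

lemma integral_abs_q_le:
  assumes "a \<le> s" "s \<le> t" "t \<le> a+1"
  shows "integral {s..t} (\<lambda>x. \<bar>q x\<bar>) \<le> M"
  using integral_subset_le[of "{s..t}" "{a..a+1}" "\<lambda>x. \<bar>q x\<bar>"] coeffs_integrable_on[of s t] q_int assms by auto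

text \<open>Integrates \<open>\<bar>y\<bar> \<le> \<delta> * y\<^sup>2 + 1 / \<delta>\<close>.
  Fixing a small \<open>\<delta>\<close> first and a short interval afterwards makes the integral of
  \<open>\<bar>\<sigma>\<bar>\<close> small uniformly in position; this is where square
  integrability enters.\<close>

lemma integral_abs_\<sigma>_le:
  assumes "a \<le> s" "s \<le> t" "t \<le> a+1" and "\<delta> > 0"
  shows "integral {s..t} (\<lambda>x. \<bar>\<sigma> x\<bar>) \<le> \<delta> * M + (t - s) / \<delta>"
proof -
  have amgm: "\<bar>y\<bar> \<le> \<delta> * y\<^sup>2 + 1 / \<delta>" for y :: real
  proof (cases "\<bar>y\<bar> \<le> 1/\<delta>")
    case True
    then show ?thesis using \<open>\<delta> > 0\<close> by (smt (verit) mult_nonneg_nonneg zero_le_power2)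
  next
    case False
    then have "1 \<le> \<delta> * \<bar>y\<bar>" using \<open>\<delta> > 0\<close> by (simp add: field_simps)
    then have "1 * \<bar>y\<bar> \<le> \<delta> * \<bar>y\<bar> * \<bar>y\<bar>" by (rule mult_right_mono) simp
    then show ?thesis using \<open>\<delta> > 0\<close> by (simp add: power2_eq_square mult.assoc) (smt (verit) divide_pos_pos)
  qed
  have i: "((\<lambda>x. \<delta> * (\<sigma> x)\<^sup>2 + 1/\<delta>) has_integral (\<delta> * integral {s..t} (\<lambda>x. (\<sigma> x)\<^sup>2) + (t - s) * (1/\<delta>))) {s..t}"
    using coeffs_integrable_on(2)[OF assms(1,3)] has_integral_const_real[of "1/\<delta>" s t] assms
    by (intro has_integral_add has_integral_mult_right) (auto simp: integrable_integral)
  have "integral {s..t} (\<lambda>x. \<bar>\<sigma> x\<bar>) \<le> \<delta> * integral {s..t} (\<lambda>x. (\<sigma> x)\<^sup>2) + (t - s) * (1/\<delta>)"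
    using integral_le[OF coeffs_integrable_on(1)[OF assms(1,3)] has_integral_integrable[OF i]] amgm integral_unique[OF i]
    by auto
  also have "integral {s..t} (\<lambda>x. (\<sigma> x)\<^sup>2) \<le> M"
    using integral_subset_le[of "{s..t}" "{a..a+1}" "\<lambda>x. (\<sigma> x)\<^sup>2"] coeffs_integrable_on[of s t] \<sigma>2_int assms by auto
  finally show ?thesis using \<open>\<delta> > 0\<close> by (simp add: mult_left_mono)
qed

text \<open>The sum norm instead of the Euclidean one: increments are estimated by plain triangle
  inequalities, and its square dominates the squared Euclidean norm.\<close>

definition amp :: "real \<Rightarrow> real" where "amp x = norm (u x) + norm (v x)"

lemma u_diff_le:
  assumes st: "a \<le> s" "s \<le> t" "t \<le> a+1" and Y: "\<And>x. x \<in> {s..t} \<Longrightarrow> amp x \<le> Y"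
  shows "norm (u t - u s) \<le> Y * (t - s + integral {s..t} (\<lambda>x. \<bar>\<sigma> x\<bar>))"
proof -
  have i: "((\<lambda>x. Y * (1 + \<bar>\<sigma> x\<bar>)) has_integral (Y * (t - s + integral {s..t} (\<lambda>x. \<bar>\<sigma> x\<bar>)))) {s..t}"
    using integrable_integral[OF coeffs_integrable_on(1)[OF st(1,3)]] has_integral_const_real[of "1::real" s t] st
    by (intro has_integral_mult_right has_integral_add) auto
  have "norm (v x + of_real (\<sigma> x) * u x) \<le> Y * (1 + \<bar>\<sigma> x\<bar>)" if "x \<in> {s..t}" for x
  proof -
    have "norm (v x + of_real (\<sigma> x) * u x) \<le> norm (v x) + \<bar>\<sigma> x\<bar> * norm (u x)"
      by (metis norm_mult norm_of_real norm_triangle_ineq)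
    also have "\<dots> \<le> Y + \<bar>\<sigma> x\<bar> * Y"
      using Y[OF that] norm_ge_zero[of "u x"] norm_ge_zero[of "v x"] unfolding amp_def
      by (intro add_mono mult_left_mono) linarith+
    finally show ?thesis by (simp add: algebra_simps)
  qed
  then have "norm (integral {s..t} (\<lambda>x. v x + of_real (\<sigma> x) * u x)) \<le> integral {s..t} (\<lambda>x. Y * (1 + \<bar>\<sigma> x\<bar>))"
    using u_int[OF st] i by (intro integral_norm_bound_integral) auto
  then show ?thesis by (simp only: integral_unique[OF i] integral_unique[OF u_int[OF st]])
qed

text \<open>Separate bounds for \<open>u\<close> and \<open>v\<close> are kept because the argument
  for a large value of \<open>u\<close> uses a much smaller bound for \<open>u\<close> than for
  \<open>v\<close>.\<close>

lemma v_diff_le: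
  assumes st: "a \<le> s" "s \<le> t" "t \<le> a+1" and U: "\<And>x. x \<in> {s..t} \<Longrightarrow> norm (u x) \<le> U"
    and V: "\<And>x. x \<in> {s..t} \<Longrightarrow> norm (v x) \<le> V"
  shows "norm (v t - v s) \<le> U * integral {s..t} (\<lambda>x. \<bar>q x\<bar>) + V * integral {s..t} (\<lambda>x. \<bar>\<sigma> x\<bar>)"
proof -
  have i: "((\<lambda>x. U * \<bar>q x\<bar> + V * \<bar>\<sigma> x\<bar>) has_integral (U * integral {s..t} (\<lambda>x. \<bar>q x\<bar>) + V * integral {s..t} (\<lambda>x. \<bar>\<sigma> x\<bar>))) {s..t}"
    using coeffs_integrable_on[OF st(1,3)]
    by (intro has_integral_add has_integral_mult_right) (auto simp: integrable_integral)
  have "norm (of_real (q x) * u x - of_real (\<sigma> x) * v x) \<le> U * \<bar>q x\<bar> + V * \<bar>\<sigma> x\<bar>" if "x \<in> {s..t}" for x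
  proof -
    have "norm (of_real (q x) * u x - of_real (\<sigma> x) * v x) \<le> norm (u x) * \<bar>q x\<bar> + norm (v x) * \<bar>\<sigma> x\<bar>"
      using norm_triangle_ineq4[of "of_real (q x) * u x" "of_real (\<sigma> x) * v x"]
      by (simp add: norm_mult mult.commute)
    also have "\<dots> \<le> U * \<bar>q x\<bar> + V * \<bar>\<sigma> x\<bar>"
      using U[OF that] V[OF that] by (intro add_mono mult_right_mono) auto
    finally show ?thesis .
  qed
  then have "norm (integral {s..t} (\<lambda>x. of_real (q x) * u x - of_real (\<sigma> x) * v x)) \<le> integral {s..t} (\<lambda>x. U * \<bar>q x\<bar> + V * \<bar>\<sigma> x\<bar>)"
    using v_int[OF st] i by (intro integral_norm_bound_integral) auto
  then show ?thesis by (simp only: integral_unique[OF i] integral_unique[OF v_int[OF st]])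
qed

text \<open>Gronwall with coefficient
  \<open>1 + 2 * \<bar>\<sigma> x\<bar> + \<bar>q x\<bar>\<close>. Taking
  \<open>\<delta> = 1/2\<close> bounds the integral of \<open>\<bar>\<sigma>\<bar>\<close> by
  \<open>M / 2 + 2\<close>, so the coefficient has integral at most \<open>2 * M + 5\<close>, half
  of the threshold for \<open>n\<close>.\<close>

lemma amp_comparable:
  assumes "4 * M + 10 \<le> real n" and xy: "x \<in> {a..a+1}" "y \<in> {a..a+1}"
  shows "amp x \<le> 2 ^ n * amp y"
proof (rule gronwall_power[where f = amp and p = x and q = y and A = "\<lambda>x. 1 + 2 * \<bar>\<sigma> x\<bar> + \<bar>q x\<bar>" and a = a and b = "a+1"])
  have i: "((\<lambda>x. 1 + 2 * \<bar>\<sigma> x\<bar> + \<bar>q x\<bar>) has_integral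
     (t - s + 2 * integral {s..t} (\<lambda>x. \<bar>\<sigma> x\<bar>) + integral {s..t} (\<lambda>x. \<bar>q x\<bar>))) {s..t}"
    if "a \<le> s" "s \<le> t" "t \<le> a+1" for s t
    using coeffs_integrable_on[OF that(1,3)] that has_integral_const_real[of "1::real" s t]
    by (intro has_integral_add has_integral_mult_right) (auto simp: integrable_integral)
  show "(\<lambda>x. 1 + 2 * \<bar>\<sigma> x\<bar> + \<bar>q x\<bar>) integrable_on {a..a+1}"
    using i[of a "a+1"] by auto
  have "integral {a..a+1} (\<lambda>x. \<bar>\<sigma> x\<bar>) \<le> (1/2) * M + 2"
    using integral_abs_\<sigma>_le[of a "a+1" "1/2"] by auto
  then show "integral {a..a+1} (\<lambda>x. 1 + 2 * \<bar>\<sigma> x\<bar> + \<bar>q x\<bar>) \<le> real n / 2"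
    using integral_unique[OF i[of a "a+1"]] q_int(2) assms(1) M by auto
  show "continuous_on {a..a+1} amp"
    unfolding amp_def by (intro continuous_intros cont)
  have step: "\<bar>amp t - amp s\<bar> \<le> Y * integral {s..t} (\<lambda>x. 1 + 2 * \<bar>\<sigma> x\<bar> + \<bar>q x\<bar>)"
    
      if st: "a \<le> s" "s \<le> t" "t \<le> a+1" and Y: "\<And>x. x \<in> {s..t} \<Longrightarrow> amp x \<le> Y" for s t Y
  proof -
    have uv: "norm (u x) \<le> Y" "norm (v x) \<le> Y" if "x \<in> {s..t}" for x
      using Y[OF that] norm_ge_zero[of "u x"] norm_ge_zero[of "v x"] unfolding amp_def by linarith+
    have "\<bar>amp t - amp s\<bar> \<le> norm (u t - u s) + norm (v t - v s)"
      unfolding amp_def using norm_triangle_ineq3[of "u t" "u s"] norm_triangle_ineq3[of "v t" "v s"] by linarith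
    also have "\<dots> \<le> Y * (t - s + integral {s..t} (\<lambda>x. \<bar>\<sigma> x\<bar>)) +
       (Y * integral {s..t} (\<lambda>x. \<bar>q x\<bar>) + Y * integral {s..t} (\<lambda>x. \<bar>\<sigma> x\<bar>))"
      using u_diff_le[OF st Y] v_diff_le[OF st uv] by (intro add_mono)
    also have "\<dots> = Y * integral {s..t} (\<lambda>x. 1 + 2 * \<bar>\<sigma> x\<bar> + \<bar>q x\<bar>)"
      unfolding integral_unique[OF i[OF st]] by (simp add: algebra_simps)
    finally show ?thesis .
  qed
  show "\<bar>amp t - amp s\<bar> \<le> Y * integral {s..t} (\<lambda>x. 1 + 2 * \<bar>\<sigma> x\<bar> + \<bar>q x\<bar>)"
    if "a \<le> s" "s \<le> t" "t \<le> a+1" "\<And>x. x \<in> {s..t} \<Longrightarrow> amp x \<le> Y" for s t Y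
    using that by (rule step)
qed (use xy in \<open>auto simp: amp_def\<close>)

text \<open>The oscillation bound keeps \<open>norm (u x)\<close> above \<open>\<eta> / 2\<close> on
  an interval of length \<open>h\<close> with endpoint \<open>t0\<close>.\<close>

lemma integral_norm_sq_ge:
  assumes t0: "t0 \<in> {a..a+1}" "\<eta> \<le> norm (u t0)" and h: "0 < h" "h \<le> 1/2"
    and osc: "\<And>s t. a \<le> s \<Longrightarrow> s \<le> t \<Longrightarrow> t \<le> a+1 \<Longrightarrow> t - s \<le> h \<Longrightarrow> norm (u t - u s) \<le> \<eta> / 2"
    and "0 \<le> \<eta>"
  shows "h * (\<eta> / 2)\<^sup>2 \<le> integral {a..a+1} (\<lambda>x. (norm (u x))\<^sup>2)"
proof -
  \<comment> \<open>Since \<open>h \<le> 1/2\<close>, the short interval fits to the right of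
    \<open>t0\<close> in the left half of the window and to its left otherwise.\<close>
  obtain s t where st: "a \<le> s" "s \<le> t" "t \<le> a+1" "t - s = h" "t0 \<in> {s..t}"
  proof (cases "t0 \<le> a + 1/2")
    case True
    show ?thesis by (rule that[of t0 "t0 + h"]) (use True h t0 in auto)
  next
    case False
    show ?thesis by (rule that[of "t0 - h" t0]) (use False h t0 in auto)
  qed
  have ci: "(\<lambda>x. (norm (u x))\<^sup>2) integrable_on {s..t}" if "a \<le> s" "t \<le> a+1" for s t
    using continuous_on_subset[OF cont(1), of "{s..t}"] that
    by (intro integrable_continuous_real continuous_intros) auto
  have low: "\<eta> / 2 \<le> norm (u x)" if "x \<in> {s..t}" for x
  proof -
    have "norm (u x - u t0) \<le> \<eta> / 2"
      using osc[of x t0] osc[of t0 x] st that by (cases "x \<le> t0") (auto simp: norm_minus_commute)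
    then show ?thesis using t0(2) norm_triangle_ineq2[of "u t0" "u x"] by (simp add: norm_minus_commute)
  qed
  have "h * (\<eta> / 2)\<^sup>2 = integral {s..t} (\<lambda>x. (\<eta> / 2)\<^sup>2)"
    using st(2,4) by simp
  also have "\<dots> \<le> integral {s..t} (\<lambda>x. (norm (u x))\<^sup>2)"
  proof (rule integral_le)
    show "(\<eta> / 2)\<^sup>2 \<le> (norm (u x))\<^sup>2" if "x \<in> {s..t}" for x
      using low[OF that] \<open>0 \<le> \<eta>\<close> by (intro power_mono) simp_all
  qed (use ci[OF st(1,3)] in \<open>simp_all add: integrable_const_ivl\<close>)
  also have "\<dots> \<le> integral {a..a+1} (\<lambda>x. (norm (u x))\<^sup>2)"
  proof (rule integral_subset_le)
    show "{s..t} \<subseteq> {a..a+1}" using st(1,3) by simp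
    show "(\<lambda>x. (norm (u x))\<^sup>2) integrable_on {s..t}" by (rule ci[OF st(1,3)])
    show "(\<lambda>x. (norm (u x))\<^sup>2) integrable_on {a..a+1}" by (rule ci) simp_all
  qed simp
  finally show ?thesis .
qed

text \<open>If \<open>u\<close> were below \<open>\<eta> * Y\<close> everywhere, \<open>v\<close>
  would carry nearly all of \<open>amp a\<close>, which is at least \<open>c * Y\<close>. The bounds
  on \<open>\<eta> * M\<close> and on the integral of \<open>\<bar>\<sigma>\<bar>\<close> keep
  \<open>v\<close> close to \<open>v a\<close> on \<open>{a..a+h}\<close>, so \<open>u\<close> would
  have to move by about \<open>h * norm (v a)\<close>, which \<open>\<eta> \<le> h * c / 8\<close>
  excludes.\<close>

lemma exists_large_u:
  assumes n: "4 * M + 10 \<le> real n" and c: "c = 1 / 2 ^ n"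
    and Y: "0 < Y" "\<And>x. x \<in> {a..a+1} \<Longrightarrow> amp x \<le> Y" "x0 \<in> {a..a+1}" "amp x0 = Y"
    and h: "0 < h" "h \<le> 1" "\<And>s t. a \<le> s \<Longrightarrow> s \<le> t \<Longrightarrow> t \<le> a+1 \<Longrightarrow> t - s \<le> h \<Longrightarrow>
        integral {s..t} (\<lambda>x. \<bar>\<sigma> x\<bar>) \<le> c / 8"
    and \<eta>: "0 < \<eta>" "\<eta> \<le> h * c / 8" "\<eta> * M \<le> c / 8"
  shows "\<exists>t\<in>{a..a+1}. \<eta> * Y \<le> norm (u t)"
proof (rule ccontr)
  assume neg: "\<not> ?thesis"
  then have u: "norm (u t) < \<eta> * Y" if "t \<in> {a..a+1}" for t using that by force
  have c01: "0 < c" "c \<le> 1" by (auto simp: c)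
  have "c * Y \<le> amp a"
    using amp_comparable[OF n Y(3), of a] Y(4) by (simp add: c field_simps)
  moreover have \<eta>c: "\<eta> \<le> c / 8"
    using \<eta>(2) mult_right_mono[OF h(2), of c] c01 by linarith
  ultimately have va: "3/4 * c * Y \<le> norm (v a)"
    using u[of a] mult_right_mono[OF \<eta>c less_imp_le[OF Y(1)]] mult_pos_pos[OF c01(1) Y(1)] by (simp add: amp_def)
  have vY: "norm (v x) \<le> Y" if "x \<in> {a..a+1}" for x
    using Y(2)[OF that] norm_ge_zero[of "u x"] unfolding amp_def by linarith
  have dv: "norm (v x - v a) \<le> c * Y / 4" if x: "x \<in> {a..a+h}" for x
  proof -
    have ax: "a \<le> a" "a \<le> x" "x \<le> a + 1" using x h(1,2) by auto
    have "norm (v x - v a) \<le> \<eta> * Y * integral {a..x} (\<lambda>x. \<bar>q x\<bar>) + Y * integral {a..x} (\<lambda>x. \<bar>\<sigma> x\<bar>)"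
      using ax by (intro v_diff_le less_imp_le[OF u] vY) auto
    also have "\<dots> \<le> \<eta> * Y * M + Y * (c/8)"
      using integral_abs_q_le[OF ax] h(3)[OF ax] x Y(1) \<eta>(1) by (intro add_mono mult_left_mono) auto
    also have "\<dots> \<le> c * Y / 4"
      using mult_right_mono[OF \<eta>(3) less_imp_le[OF Y(1)]] by (simp add: algebra_simps)
    finally show ?thesis .
  qed
  have ah: "a \<le> a" "a \<le> a + h" "a + h \<le> a + 1" using h(1,2) by auto
  \<comment> \<open>Subtracting the constant \<open>v a\<close> under the integral isolates the
    deviation of the increment of \<open>u\<close> from its linear prediction.\<close>
  have i1: "((\<lambda>x. v x + of_real (\<sigma> x) * u x - v a) has_integral (u (a+h) - u a - h *\<^sub>R v a)) {a..a+h}"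
    using has_integral_diff[OF u_int[OF ah] has_integral_const_real[of "v a" a "a+h"]] h(1,2) by simp
  have i2: "((\<lambda>x. c * Y / 4 + \<eta> * Y * \<bar>\<sigma> x\<bar>) has_integral
      (h * (c * Y / 4) + \<eta> * Y * integral {a..a+h} (\<lambda>x. \<bar>\<sigma> x\<bar>))) {a..a+h}"
    using coeffs_integrable_on(1)[OF ah(1,3)] has_integral_const_real[of "c * Y / 4" a "a+h"] h(1,2)
    by (intro has_integral_add has_integral_mult_right) (auto simp: integrable_integral)
  have "norm (v x + of_real (\<sigma> x) * u x - v a) \<le> c * Y / 4 + \<eta> * Y * \<bar>\<sigma> x\<bar>" if x: "x \<in> {a..a+h}" for x
  proof -
    have "norm (v x + of_real (\<sigma> x) * u x - v a) \<le> norm (v x - v a) + norm (u x) * \<bar>\<sigma> x\<bar>"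
      using norm_triangle_ineq[of "v x - v a" "of_real (\<sigma> x) * u x"]
      by (simp add: norm_mult mult.commute algebra_simps)
    also have "\<dots> \<le> c * Y / 4 + \<eta> * Y * \<bar>\<sigma> x\<bar>"
      using dv[OF x] u[of x] x h(1,2) by (intro add_mono mult_right_mono) auto
    finally show ?thesis .
  qed
  then have "norm (u (a+h) - u a - h *\<^sub>R v a) \<le> h * (c * Y / 4) + \<eta> * Y * integral {a..a+h} (\<lambda>x. \<bar>\<sigma> x\<bar>)"
    using integral_norm_bound_integral[OF has_integral_integrable[OF i1] has_integral_integrable[OF i2]]
    by (simp only: integral_unique[OF i1] integral_unique[OF i2])
  \<comment> \<open>A crude bound suffices for the integral of \<open>\<bar>\<sigma>\<bar>\<close>:
    it is at most \<open>c / 8\<close>, hence at most 1.\<close>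
  also have "\<dots> \<le> h * (c * Y / 4) + \<eta> * Y * 1"
    using h(1) h(3)[OF ah] c01 \<eta>(1) Y(1) by (intro add_mono mult_left_mono) auto
  finally have "h * norm (v a) \<le> norm (u (a+h)) + norm (u a) + h * (c * Y / 4) + \<eta> * Y"
    using norm_triangle_ineq4[of "u (a+h)" "u a"] norm_triangle_ineq2[of "h *\<^sub>R v a" "u (a+h) - u a"] h(1)
    by (simp add: norm_minus_commute)
  moreover have "norm (u (a+h)) < \<eta> * Y" "norm (u a) < \<eta> * Y" using u[of "a+h"] u[of a] h(1,2) by auto
  moreover have "h * (3/4 * c * Y) \<le> h * norm (v a)" using va h(1,2) by (intro mult_left_mono) auto
  moreover have "\<eta> * Y \<le> h * c / 8 * Y" using \<eta>(2) Y(1) by (intro mult_right_mono) auto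
  moreover have "0 < h * c * Y" using h(1) c01 Y(1) by simp
  \<comment> \<open>In units of \<open>h * c * Y\<close>: the left side is at least 3/4, while the
    three terms \<open>\<eta> * Y\<close> give at most 3/8 and the deviation of \<open>v\<close>
    gives 1/4.\<close>
  ultimately show False by (simp add: algebra_simps)
qed

end

text \<open>Half of \<open>\<epsilon>\<close> pays for \<open>\<delta> * M\<close>, which fixes
  \<open>\<delta>\<close>; \<open>h\<close> is then small enough for the other half. The first two
  summands match the bound for the integral of \<open>\<bar>\<sigma>\<bar>\<close>, and the extra
  \<open>h\<close> absorbs the length term in the increment of \<open>u\<close>.\<close>

lemma small_step:
  fixes M \<epsilon> :: real
  assumes "1 \<le> M" "0 < \<epsilon>"
  obtains h \<delta> where "0 < h" "h \<le> 1/2" "0 < \<delta>" "\<delta> * M + h / \<delta> + h \<le> \<epsilon>"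
proof -
  define \<delta> where "\<delta> = \<epsilon> / (2 * M)"
  define h where "h = min (1/2) (\<epsilon> / 2 / (1 + 1 / \<delta>))"
  have d: "0 < \<delta>" using assms by (simp add: \<delta>_def)
  then have p: "0 < 1 + 1 / \<delta>" by (simp add: add_pos_pos)
  have "h * (1 + 1 / \<delta>) \<le> \<epsilon> / 2 / (1 + 1 / \<delta>) * (1 + 1 / \<delta>)"
    using p by (intro mult_right_mono) (auto simp: h_def)
  also have "\<dots> = \<epsilon> / 2" using p by (metis less_irrefl nonzero_eq_divide_eq)
  finally have "h / \<delta> + h \<le> \<epsilon> / 2" by (simp add: algebra_simps)
  moreover have "\<delta> * M = \<epsilon> / 2" using assms by (simp add: \<delta>_def)
  moreover have "0 < h" using p assms by (simp add: h_def)
  moreover have "h \<le> 1/2" unfolding h_def by (rule min.cobounded1)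
  ultimately show ?thesis
    by (intro that[of h \<delta>]) (use d in linarith)+
qed

text \<open>The constants are chosen in the order \<open>n\<close>, \<open>c\<close>,
  \<open>h\<close>, \<open>\<eta>\<close>, \<open>k\<close> from \<open>M\<close> alone, so
  \<open>C\<close> is uniform in the window, the coefficients and the solution.\<close>

proposition first_order_system_local_bound:
  assumes "1 \<le> M"
  obtains C where "0 < C"
    "\<And>a \<sigma> q u v x. first_order_system a M \<sigma> q u v \<Longrightarrow> x \<in> {a..a+1} \<Longrightarrow>
      (norm (u x))\<^sup>2 + (norm (v x))\<^sup>2 \<le> C * integral {a..a+1} (\<lambda>x. (norm (u x))\<^sup>2)"
proof -
  obtain n :: nat where n: "4 * M + 10 \<le> real n" using real_arch_simple by blast
  define c :: real where "c = 1 / 2 ^ n"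
  have c: "0 < c" by (simp add: c_def)
  obtain h \<delta> where h: "0 < h" "h \<le> 1/2" "0 < \<delta>" "\<delta> * M + h / \<delta> + h \<le> c / 8"
    using small_step[OF assms, of "c/8"] c by auto
  define \<eta> where "\<eta> = min (h * c / 8) (c / (8 * M))"
  have \<eta>: "0 < \<eta>" "\<eta> \<le> h * c / 8" "\<eta> * M \<le> c / 8"
  proof -
    have "\<eta> * M \<le> c / (8 * M) * M" using assms by (intro mult_right_mono) (auto simp: \<eta>_def)
    then show "\<eta> * M \<le> c / 8" using assms by simp
  qed (use h c assms in \<open>auto simp: \<eta>_def\<close>)
  \<comment> \<open>A second, finer scale: \<open>h\<close> serves to find a large value of
    \<open>u\<close>, while \<open>k\<close> is a length over which \<open>u\<close> changes by at
    most \<open>\<eta> * Y / 2\<close>.\<close>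
  obtain k \<kappa> where k: "0 < k" "k \<le> 1/2" "0 < \<kappa>" "\<kappa> * M + k / \<kappa> + k \<le> \<eta> / 2"
    using small_step[OF assms, of "\<eta>/2"] \<eta> by auto
  show ?thesis
  proof (rule that[of "4 / (k * \<eta>\<^sup>2)"])
    show "0 < 4 / (k * \<eta>\<^sup>2)" using k \<eta> by simp
    fix a \<sigma> q u v x
    assume "first_order_system a M \<sigma> q u v" and x: "x \<in> {a..a+1}"
    then interpret first_order_system a M \<sigma> q u v by simp
    have "continuous_on {a..a+1} amp" unfolding amp_def by (intro continuous_intros cont)
    then obtain x0 where x0: "x0 \<in> {a..a+1}" "\<And>x. x \<in> {a..a+1} \<Longrightarrow> amp x \<le> amp x0"
      using continuous_attains_sup[of "{a..a+1}" amp] by auto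
    define Y where "Y = amp x0"
    have "0 \<le> Y" by (simp add: Y_def amp_def)
    have "(norm (u x))\<^sup>2 + (norm (v x))\<^sup>2 \<le> (amp x)\<^sup>2" by (simp add: amp_def power2_sum)
    also have "\<dots> \<le> Y\<^sup>2"
      using x0(2)[OF x] by (intro power_mono) (auto simp: Y_def amp_def)
    also have "\<dots> \<le> 4 / (k * \<eta>\<^sup>2) * integral {a..a+1} (\<lambda>x. (norm (u x))\<^sup>2)"
    \<comment> \<open>The search for a large value of \<open>u\<close> requires a positive maximum;
      the zero solution is treated apart.\<close>
    proof (cases "Y = 0")
      case True
      have "0 \<le> integral {a..a+1} (\<lambda>x. (norm (u x))\<^sup>2)"
        by (intro integral_nonneg integrable_continuous_real continuous_intros cont) auto
      then show ?thesis using k True by simp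
    next
      case False
      with \<open>0 \<le> Y\<close> have "0 < Y" by simp
      have "\<exists>t\<in>{a..a+1}. \<eta> * Y \<le> norm (u t)"
      proof (rule exists_large_u[OF n c_def \<open>0 < Y\<close> _ x0(1)])
        fix s t assume st: "a \<le> s" "s \<le> t" "t \<le> a+1" and "t - s \<le> h"
        then have "(t - s) / \<delta> \<le> h / \<delta>" using h by (intro divide_right_mono) auto
        then show "integral {s..t} (\<lambda>x. \<bar>\<sigma> x\<bar>) \<le> c / 8"
          using integral_abs_\<sigma>_le[OF st h(3)] h by linarith
      qed (use x0 Y_def h \<eta> in auto)
      then obtain t0 where t0: "t0 \<in> {a..a+1}" "\<eta> * Y \<le> norm (u t0)" by blast
      have "k * (\<eta> * Y / 2)\<^sup>2 \<le> integral {a..a+1} (\<lambda>x. (norm (u x))\<^sup>2)"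
      proof (rule integral_norm_sq_ge[OF t0 k(1,2)])
        fix s t assume st: "a \<le> s" "s \<le> t" "t \<le> a+1" and "t - s \<le> k"
        then have "(t - s) / \<kappa> \<le> k / \<kappa>" using k by (intro divide_right_mono) auto
        then have *: "t - s + integral {s..t} (\<lambda>x. \<bar>\<sigma> x\<bar>) \<le> \<eta> / 2"
          using integral_abs_\<sigma>_le[OF st k(3)] k \<open>t - s \<le> k\<close> by linarith
        have "norm (u t - u s) \<le> Y * (t - s + integral {s..t} (\<lambda>x. \<bar>\<sigma> x\<bar>))"
          by (rule u_diff_le[OF st]) (use x0 st Y_def in auto)
        also have "\<dots> \<le> Y * (\<eta> / 2)" using * \<open>0 \<le> Y\<close> by (rule mult_left_mono)
        finally show "norm (u t - u s) \<le> \<eta> * Y / 2" by (simp add: mult.commute)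
      qed (use \<eta> \<open>0 \<le> Y\<close> in auto)
      then have "4 / (k * \<eta>\<^sup>2) * (k * (\<eta> * Y / 2)\<^sup>2) \<le> 4 / (k * \<eta>\<^sup>2) * integral {a..a+1} (\<lambda>x. (norm (u x))\<^sup>2)"
        using k by (intro mult_left_mono) auto
      moreover have "4 / (k * \<eta>\<^sup>2) * (k * (\<eta> * Y / 2)\<^sup>2) = Y\<^sup>2"
        using k \<eta> by (simp add: power_mult_distrib power_divide field_simps)
      ultimately show ?thesis by simp
    qed
    finally show "(norm (u x))\<^sup>2 + (norm (v x))\<^sup>2 \<le> 4 / (k * \<eta>\<^sup>2) * integral {a..a+1} (\<lambda>x. (norm (u x))\<^sup>2)" .
  qed
qed

subsection \<open>Summation over unit intervals\<close>

text \<open>Summation separated from the differential equation. Half-open windows tile intervals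
  without overlap, and values in \<open>ennreal\<close> avoid any integrability question.\<close>

context
  fixes g G :: "real \<Rightarrow> ennreal" and C :: ennreal
  assumes g: "g \<in> borel_measurable lebesgue" and G: "G \<in> borel_measurable lebesgue"
    and window: "\<And>a x. 0 < a \<Longrightarrow> x \<in> {a<..a+1} \<Longrightarrow> G x \<le> C * (\<integral>\<^sup>+t\<in>{a<..a+1}. g t \<partial>lebesgue)"
begin

text \<open>The bound for \<open>G\<close> is constant on a window of length 1, so integration over
  the window reproduces it; the windows are added one by one.\<close>

lemma set_nn_integral_windows_le:
  assumes "0 < a"
  shows "(\<integral>\<^sup>+x\<in>{a<..a+real n}. G x \<partial>lebesgue) \<le> C * (\<integral>\<^sup>+x\<in>{a<..a+real n}. g x \<partial>lebesgue)"
proof (induction n)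
  case 0
  then show ?case by simp
next
  case (Suc n)
  let ?b = "a + real n"
  have b: "0 < ?b" using assms by simp
  have eq: "{a<..a+real (Suc n)} = {a<..?b} \<union> {?b<..?b+1}" by auto
  have disj: "{a<..?b} \<inter> {?b<..?b+1} = {}" by auto
  have "(\<integral>\<^sup>+x\<in>{?b<..?b+1}. G x \<partial>lebesgue) \<le>
      (\<integral>\<^sup>+x\<in>{?b<..?b+1}. C * (\<integral>\<^sup>+t\<in>{?b<..?b+1}. g t \<partial>lebesgue) \<partial>lebesgue)"
    using window[OF b] by (intro nn_integral_mono) (auto simp: indicator_def)
  also have "\<dots> = C * (\<integral>\<^sup>+t\<in>{?b<..?b+1}. g t \<partial>lebesgue)"
    by (subst nn_integral_cmult_indicator) auto
  finally show ?case
    unfolding eq using Suc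
    by (subst (1 2) nn_integral_disjoint_pair[OF _ _ _ disj])
      (auto simp: g G distrib_left intro: add_mono)
qed

text \<open>Windows must start at a positive point, so the half-line is exhausted by finite unions
  of windows whose left ends tend to 0, and monotone convergence applies.\<close>

lemma set_nn_integral_half_line_le:
  "(\<integral>\<^sup>+x\<in>{0<..}. G x \<partial>lebesgue) \<le> C * (\<integral>\<^sup>+x\<in>{0<..}. g x \<partial>lebesgue)"
proof -
  define c where "c n = 1 / (real n + 1)" for n
  define A where "A n = {c n <.. c n + real n}" for n
  have c: "0 < c n" "c n \<le> 1" "c (Suc n) \<le> c n" for n
    by (simp_all add: c_def frac_le add_nonneg_pos)
  \<comment> \<open>The right ends increase although \<open>c n\<close> decreases, because
    \<open>c n\<close> drops by less than 1 while \<open>real n\<close> grows by 1.\<close>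
  have inc: "incseq A"
  proof (rule incseq_SucI)
    show "A n \<subseteq> A (Suc n)" for n
      using c[of n] c[of "Suc n"] by (auto simp: A_def)
  qed
  have un: "(\<Union>n. A n) = {0<..}"
  proof (intro equalityI subsetI)
    fix x :: real assume "x \<in> {0<..}"
    then have x: "0 < x" by simp
    obtain m where m: "inverse (real (Suc m)) < x" using reals_Archimedean[OF x] by blast
    obtain k :: nat where k: "x \<le> real k" using real_arch_simple by blast
    define n where "n = max m k"
    have "c n \<le> 1 / (real m + 1)" unfolding c_def by (intro divide_left_mono) (auto simp: n_def)
    also have "\<dots> < x" using m by (simp add: inverse_eq_divide add.commute)
    finally have "c n < x" .
    moreover have "x \<le> c n + real n"
      using k c(1)[of n] by (simp add: n_def)
    ultimately show "x \<in> (\<Union>n. A n)" by (auto simp: A_def)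
  next
    fix x assume "x \<in> (\<Union>n. A n)"
    then show "x \<in> {0<..}" using c(1) by (auto simp: A_def intro: less_trans)
  qed
  have "(\<integral>\<^sup>+x\<in>{0<..}. G x \<partial>lebesgue) = emeasure (density lebesgue G) (\<Union>n. A n)"
    unfolding un by (simp add: emeasure_density G)
  also have "\<dots> = (SUP n. emeasure (density lebesgue G) (A n))"
    by (rule SUP_emeasure_incseq[OF _ inc, symmetric]) (auto simp: A_def)
  also have "\<dots> \<le> C * (\<integral>\<^sup>+x\<in>{0<..}. g x \<partial>lebesgue)"
  proof (rule SUP_least)
    fix n
    have "emeasure (density lebesgue G) (A n) = (\<integral>\<^sup>+x\<in>A n. G x \<partial>lebesgue)"
      by (simp add: emeasure_density G A_def)
    also have "\<dots> \<le> C * (\<integral>\<^sup>+x\<in>A n. g x \<partial>lebesgue)"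
      unfolding A_def by (rule set_nn_integral_windows_le[OF c(1)])
    also have "\<dots> \<le> C * (\<integral>\<^sup>+x\<in>{0<..}. g x \<partial>lebesgue)"
      using un by (intro mult_left_mono nn_integral_mono) (auto simp: indicator_def)
    finally show "emeasure (density lebesgue G) (A n) \<le> C * (\<integral>\<^sup>+x\<in>{0<..}. g x \<partial>lebesgue)" .
  qed
  finally show ?thesis .
qed

end

text \<open>A window starting beyond \<open>n\<close> lies in the tail \<open>{real n<..}\<close>,
  and the tails of a finite integral vanish by continuity from above.\<close>

lemma set_nn_integral_window_tendsto_0:
  fixes g :: "real \<Rightarrow> ennreal"
  assumes g: "g \<in> borel_measurable lebesgue" and fin: "(\<integral>\<^sup>+x\<in>{0<..}. g x \<partial>lebesgue) < \<infinity>"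
  shows "((\<lambda>x. \<integral>\<^sup>+t\<in>{x<..x+1}. g t \<partial>lebesgue) \<longlongrightarrow> 0) at_top"
proof -
  have tail: "emeasure (density lebesgue g) {real n<..} = (\<integral>\<^sup>+t\<in>{real n<..}. g t \<partial>lebesgue)" for n
    by (simp add: emeasure_density g)
  have le: "(\<integral>\<^sup>+t\<in>{real n<..}. g t \<partial>lebesgue) \<le> (\<integral>\<^sup>+x\<in>{0<..}. g x \<partial>lebesgue)" for n
    by (intro nn_integral_mono) (auto simp: indicator_def)
  have "(\<lambda>n. emeasure (density lebesgue g) {real n<..}) \<longlonglongrightarrow> emeasure (density lebesgue g) (\<Inter>n. {real n<..})"
    using less_imp_neq[OF order_le_less_trans[OF le fin]] by (intro Lim_emeasure_decseq) (auto simp: tail decseq_def)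
  moreover have "(\<Inter>n. {real n<..}) = {}"
    by (auto simp: set_eq_iff not_less intro: real_arch_simple)
  ultimately have lim: "(\<lambda>n. \<integral>\<^sup>+t\<in>{real n<..}. g t \<partial>lebesgue) \<longlonglongrightarrow> 0"
    by (simp add: tail)
  show ?thesis
  proof (rule order_tendstoI)
    fix e :: ennreal assume "0 < e"
    then have "eventually (\<lambda>n. (\<integral>\<^sup>+t\<in>{real n<..}. g t \<partial>lebesgue) < e) sequentially"
      by (rule order_tendstoD[OF lim])
    then obtain n where n: "(\<integral>\<^sup>+t\<in>{real n<..}. g t \<partial>lebesgue) < e"
      by (auto simp: eventually_sequentially)
    show "eventually (\<lambda>x. (\<integral>\<^sup>+t\<in>{x<..x+1}. g t \<partial>lebesgue) < e) at_top"
      using eventually_ge_at_top[of "real n"]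
    proof eventually_elim
      fix x assume "real n \<le> x"
      then have "(\<integral>\<^sup>+t\<in>{x<..x+1}. g t \<partial>lebesgue) \<le> (\<integral>\<^sup>+t\<in>{real n<..}. g t \<partial>lebesgue)"
        by (intro nn_integral_mono) (auto simp: indicator_def)
      then show "(\<integral>\<^sup>+t\<in>{x<..x+1}. g t \<partial>lebesgue) < e" using n by (rule order_le_less_trans)
    qed
  qed simp
qed

section \<open>Passage between nonnegative Lebesgue integrals and gauge integrals\<close>

lemma integrable_on_nn_integral_bound:
  fixes f :: "real \<Rightarrow> real"
  assumes f: "f \<in> borel_measurable (lebesgue_on {0<..})" "\<And>x. 0 \<le> f x"
    and "0 < a" "0 \<le> B" and bound: "(\<integral>\<^sup>+t\<in>{a..b}. ennreal (f t) \<partial>lebesgue) \<le> ennreal B"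
  shows "f integrable_on {a..b}" "integral {a..b} f \<le> B"
proof -
  have "f \<in> borel_measurable (lebesgue_on {a..b})"
    by (rule measurable_restrict_mono[OF f(1)]) (use \<open>0 < a\<close> in auto)
  then have m: "(\<lambda>x. if x \<in> {a..b} then f x else 0) \<in> borel_measurable lebesgue"
    by (rule borel_measurable_if_I) simp
  have eq: "(\<integral>\<^sup>+t\<in>{a..b}. ennreal (f t) \<partial>lebesgue) = (\<integral>\<^sup>+t. ennreal (if t \<in> {a..b} then f t else 0) \<partial>lebesgue)"
    by (intro nn_integral_cong) (auto simp: indicator_def)
  define r where "r = enn2real (\<integral>\<^sup>+t\<in>{a..b}. ennreal (f t) \<partial>lebesgue)"
  have r: "(\<integral>\<^sup>+t\<in>{a..b}. ennreal (f t) \<partial>lebesgue) = ennreal r"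
    unfolding r_def using bound by (metis ennreal_enn2real ennreal_less_top order_le_less_trans)
  have "((\<lambda>x. if x \<in> {a..b} then f x else 0) has_integral r) UNIV"
    using m r eq f(2) by (subst has_integral_iff_nn_integral_lebesgue) (auto simp: r_def)
  then have hi: "(f has_integral r) {a..b}"
    by (simp only: has_integral_restrict_UNIV)
  then show "f integrable_on {a..b}" by blast
  have "r \<le> B" using bound r \<open>0 \<le> B\<close> by simp
  then show "integral {a..b} f \<le> B" using hi by (simp add: integral_unique)
qed

text \<open>The endpoint \<open>a\<close> is a null set; dropping it fits the integral to the
  half-open windows.\<close>

lemma ennreal_integral_Ioc:
  fixes f :: "real \<Rightarrow> real"
  assumes "f integrable_on {a..b}" "\<And>x. 0 \<le> f x"
  shows "ennreal (integral {a..b} f) = (\<integral>\<^sup>+t\<in>{a<..b}. ennreal (f t) \<partial>lebesgue)"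
proof -
  have "ennreal (integral {a..b} f) = (\<integral>\<^sup>+x. ennreal (indicator {a..b} x * f x) \<partial>lborel)"
    using nn_integral_has_integral_lebesgue[OF assms(2) integrable_integral[OF assms(1)]] by simp
  also have "\<dots> = (\<integral>\<^sup>+x. ennreal (indicator {a..b} x * f x) \<partial>lebesgue)"
    by (simp add: nn_integral_completion)
  also have "\<dots> = (\<integral>\<^sup>+t\<in>{a<..b}. ennreal (f t) \<partial>lebesgue)"
    by (intro nn_integral_cong_AE eventually_mono[OF AE_completion[OF AE_lborel_singleton[of a]]])
      (auto simp: indicator_def)
  finally show ?thesis .
qed

subsection \<open>Weighted bounds for solutions\<close>

lemma AE_lebesgue_on_half_lineE:
  assumes "AE x in lebesgue_on {0<..}. P (x::real)"
  obtains N where "negligible N" "\<And>x. 0 < x \<Longrightarrow> x \<notin> N \<Longrightarrow> P x"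
proof -
  have "AE x in lebesgue. x \<in> {0<..} \<longrightarrow> P x"
    using assms by (subst (asm) AE_restrict_space_iff) auto
  then obtain N where "negligible N" "{x. \<not> (x \<in> {0<..} \<longrightarrow> P x)} \<subseteq> N"
    unfolding eventually_ae_filter_negligible by blast
  then show ?thesis by (intro that[of N]) auto
qed

lemma AC_loc_has_integral:
  assumes f: "f \<in> AC_loc" "has_ae_deriv f f'" and eq: "AE x in lebesgue_on {0<..}. f' x = g x"
    and st: "0 < s" "s \<le> t"
  shows "(g has_integral (f t - f s)) {s..t}"
proof -
  obtain N where N: "negligible N" "\<And>x. 0 < x \<Longrightarrow> x \<notin> N \<Longrightarrow> (f has_vector_derivative f' x) (at x)"
    using f(2) unfolding has_ae_deriv_def by (rule AE_lebesgue_on_half_lineE) (rule that)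
  obtain N' where N': "negligible N'" "\<And>x. 0 < x \<Longrightarrow> x \<notin> N' \<Longrightarrow> f' x = g x"
    using eq by (rule AE_lebesgue_on_half_lineE) (rule that)
  have "abs_cont_on s t f" using f(1) st by (simp add: AC_loc_def)
  then have "(f' has_integral (f t - f s)) {s..t}"
    by (rule abs_cont_on_has_integral[OF _ _ N(1)]) (use N(2) st in auto)
  then show ?thesis
    by (rule has_integral_spike[OF N'(1), rotated]) (use N'(2) st in auto)
qed

lemma AC_loc_continuous_on:
  assumes "f \<in> AC_loc" "0 < a"
  shows "continuous_on {a..b} f"
proof (cases "a \<le> b")
  case True
  with assms have "abs_cont_on a b f" by (simp add: AC_loc_def)
  then show ?thesis by (rule abs_cont_on_imp_continuous_on)
qed simp

text \<open>Membership in the domain makes the choice in \<open>quasi_deriv\<close> a genuine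
  quasi-derivative. Solving the two almost-everywhere identities for the derivatives and integrating
  gives the first-order system.\<close>

lemma solutionsD:
  assumes "u \<in> solutions \<sigma> \<tau> E"
  shows "u \<in> AC_loc" "quasi_deriv \<sigma> u \<in> AC_loc"
    and "\<And>s t. 0 < s \<Longrightarrow> s \<le> t \<Longrightarrow>
      ((\<lambda>x. quasi_deriv \<sigma> u x + of_real (\<sigma> x) * u x) has_integral (u t - u s)) {s..t}"
    and "\<And>s t. 0 < s \<Longrightarrow> s \<le> t \<Longrightarrow>
      ((\<lambda>x. of_real (\<tau> x - (\<sigma> x)\<^sup>2 - E) * u x - of_real (\<sigma> x) * quasi_deriv \<sigma> u x)
        has_integral (quasi_deriv \<sigma> u t - quasi_deriv \<sigma> u s)) {s..t}"
proof -
  show u: "u \<in> AC_loc" using assms by (simp add: solutions_def quasi_domain_def)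
  have qd: "is_quasi_deriv \<sigma> u (quasi_deriv \<sigma> u)"
  proof -
    obtain v where "is_quasi_deriv \<sigma> u v"
      using assms by (auto simp: solutions_def quasi_domain_def)
    then show ?thesis unfolding quasi_deriv_def by (rule someI[of "is_quasi_deriv \<sigma> u"])
  qed
  then show v: "quasi_deriv \<sigma> u \<in> AC_loc" by (simp add: is_quasi_deriv_def)
  fix s t :: real assume st: "0 < s" "s \<le> t"
  obtain u' where u': "has_ae_deriv u u'"
      "AE x in lebesgue_on {0<..}. quasi_deriv \<sigma> u x = u' x - of_real (\<sigma> x) * u x"
    using qd unfolding is_quasi_deriv_def by blast
  have "AE x in lebesgue_on {0<..}. u' x = quasi_deriv \<sigma> u x + of_real (\<sigma> x) * u x"
    using u'(2) by eventually_elim simp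
  then show "((\<lambda>x. quasi_deriv \<sigma> u x + of_real (\<sigma> x) * u x) has_integral (u t - u s)) {s..t}"
    by (rule AC_loc_has_integral[OF u u'(1) _ st])
  obtain v' where v': "has_ae_deriv (quasi_deriv \<sigma> u) v'"
      "AE x in lebesgue_on {0<..}. - v' x - of_real (\<sigma> x) * quasi_deriv \<sigma> u x
        + of_real (\<tau> x - (\<sigma> x)\<^sup>2) * u x = of_real E * u x"
    using assms unfolding solutions_def ell_eq_def by blast
  have "AE x in lebesgue_on {0<..}.
      v' x = of_real (\<tau> x - (\<sigma> x)\<^sup>2 - E) * u x - of_real (\<sigma> x) * quasi_deriv \<sigma> u x"
    using v'(2) by eventually_elim (simp add: algebra_simps)
  then show "((\<lambda>x. of_real (\<tau> x - (\<sigma> x)\<^sup>2 - E) * u x - of_real (\<sigma> x) * quasi_deriv \<sigma> u x)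
        has_integral (quasi_deriv \<sigma> u t - quasi_deriv \<sigma> u s)) {s..t}"
    by (rule AC_loc_has_integral[OF v v'(1) _ st])
qed

lemma SUP_less_infinity_boundE:
  fixes F :: "real \<Rightarrow> ennreal"
  assumes "(SUP x\<in>{0<..}. F x) < \<infinity>"
  obtains B where "0 \<le> B" "\<And>x. 0 < x \<Longrightarrow> F x \<le> ennreal B"
proof -
  define B where "B = enn2real (SUP x\<in>{0<..}. F x)"
  have "(SUP x\<in>{0<..}. F x) = ennreal B" unfolding B_def using assms by simp
  then have "F x \<le> ennreal B" if "0 < x" for x
    using SUP_upper[of x "{0<..}" F] that by simp
  then show ?thesis by (intro that[of B]) (auto simp: B_def)
qed

text \<open>Uniform local bounds \<open>S\<close> and \<open>T\<close> for the coefficients give a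
  bound for \<open>q\<close> through \<open>\<bar>q\<bar> \<le> \<bar>\<tau>\<bar> +
  \<sigma>\<^sup>2 + \<bar>E\<bar>\<close>; the added 1 ensures \<open>1 \<le> M\<close>.
  Integrability of \<open>\<bar>\<sigma>\<bar>\<close> follows from
  \<open>\<bar>y\<bar> \<le> 1 + y\<^sup>2\<close>.\<close>

lemma solutions_first_order_system:
  assumes \<sigma>: "\<sigma> \<in> borel_measurable (lebesgue_on {0<..})"
    and \<tau>: "\<tau> \<in> borel_measurable (lebesgue_on {0<..})"
    and \<sigma>_sup: "(SUP x\<in>{0<..}. \<integral>\<^sup>+t\<in>{x..x+1}. ennreal ((\<sigma> t)\<^sup>2) \<partial>lebesgue) < \<infinity>"
    and \<tau>_sup: "(SUP x\<in>{0<..}. \<integral>\<^sup>+t\<in>{x..x+1}. ennreal \<bar>\<tau> t\<bar> \<partial>lebesgue) < \<infinity>"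
  obtains M where "1 \<le> M" "\<And>(a::real) u. 0 < a \<Longrightarrow> u \<in> solutions \<sigma> \<tau> E \<Longrightarrow>
    first_order_system a M \<sigma> (\<lambda>x. \<tau> x - (\<sigma> x)\<^sup>2 - E) u (quasi_deriv \<sigma> u)"
proof -
  obtain S where S: "0 \<le> S" "\<And>x. 0 < x \<Longrightarrow> (\<integral>\<^sup>+t\<in>{x..x+1}. ennreal ((\<sigma> t)\<^sup>2) \<partial>lebesgue) \<le> ennreal S"
    using SUP_less_infinity_boundE[OF \<sigma>_sup] by metis
  obtain T where T: "0 \<le> T" "\<And>x. 0 < x \<Longrightarrow> (\<integral>\<^sup>+t\<in>{x..x+1}. ennreal \<bar>\<tau> t\<bar> \<partial>lebesgue) \<le> ennreal T"
    using SUP_less_infinity_boundE[OF \<tau>_sup] by metis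
  show ?thesis
  proof (rule that[of "1 + S + T + \<bar>E\<bar>"])
    show "1 \<le> 1 + S + T + \<bar>E\<bar>" using S T by simp
    fix a :: real and u assume a: "0 < a" and u: "u \<in> solutions \<sigma> \<tau> E"
    let ?I = "{a..a+1}"
    have sub: "f \<in> borel_measurable (lebesgue_on ?I)" if "f \<in> borel_measurable (lebesgue_on {0<..})" for f :: "real \<Rightarrow> real"
      by (rule measurable_restrict_mono[OF that]) (use a in auto)
    have \<sigma>2: "(\<lambda>x. (\<sigma> x)\<^sup>2) integrable_on ?I" "integral ?I (\<lambda>x. (\<sigma> x)\<^sup>2) \<le> S"
      by (rule integrable_on_nn_integral_bound[OF borel_measurable_power[OF \<sigma>] _ a S(1) S(2)[OF a]]; simp)+
    have \<tau>1: "(\<lambda>x. \<bar>\<tau> x\<bar>) integrable_on ?I" "integral ?I (\<lambda>x. \<bar>\<tau> x\<bar>) \<le> T"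
      by (rule integrable_on_nn_integral_bound[OF borel_measurable_abs[OF \<tau>] _ a T(1) T(2)[OF a]]; simp)+
    have le1: "\<bar>y\<bar> \<le> 1 + y\<^sup>2" for y :: real
    proof -
      have "0 \<le> (\<bar>y\<bar> - 1)\<^sup>2" by simp
      also have "\<dots> = y\<^sup>2 - 2 * \<bar>y\<bar> + 1" by (simp add: power2_diff)
      finally show ?thesis using zero_le_power2[of y] by linarith
    qed
    have "(\<lambda>x. 1 + (\<sigma> x)\<^sup>2) integrable_on ?I"
      by (intro integrable_add \<sigma>2(1)) (simp add: integrable_const_ivl)
    then have \<sigma>1: "(\<lambda>x. \<bar>\<sigma> x\<bar>) integrable_on ?I"
      by (rule measurable_bounded_by_integrable_imp_integrable[rotated])
        (use sub[OF \<sigma>] le1 in auto)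
    have bi: "((\<lambda>x. \<bar>\<tau> x\<bar> + (\<sigma> x)\<^sup>2 + \<bar>E\<bar>) has_integral
        (integral ?I (\<lambda>x. \<bar>\<tau> x\<bar>) + integral ?I (\<lambda>x. (\<sigma> x)\<^sup>2) + \<bar>E\<bar>)) ?I"
      using has_integral_const_real[of "\<bar>E\<bar>" a "a+1"]
      by (intro has_integral_add integrable_integral \<sigma>2(1) \<tau>1(1)) simp
    have ble: "\<bar>\<tau> x - (\<sigma> x)\<^sup>2 - E\<bar> \<le> \<bar>\<tau> x\<bar> + (\<sigma> x)\<^sup>2 + \<bar>E\<bar>" for x
      using zero_le_power2[of "\<sigma> x"] by linarith
    have q: "(\<lambda>x. \<bar>\<tau> x - (\<sigma> x)\<^sup>2 - E\<bar>) integrable_on ?I"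
      by (rule measurable_bounded_by_integrable_imp_integrable[rotated, OF has_integral_integrable[OF bi]])
        (use sub[OF \<sigma>] sub[OF \<tau>] ble in auto)
    have "integral ?I (\<lambda>x. \<bar>\<tau> x - (\<sigma> x)\<^sup>2 - E\<bar>) \<le> integral ?I (\<lambda>x. \<bar>\<tau> x\<bar> + (\<sigma> x)\<^sup>2 + \<bar>E\<bar>)"
      by (rule integral_le[OF q has_integral_integrable[OF bi]]) (rule ble)
    also have "\<dots> \<le> 1 + S + T + \<bar>E\<bar>"
      unfolding integral_unique[OF bi] using \<sigma>2(2) \<tau>1(2) by simp
    finally have q': "integral ?I (\<lambda>x. \<bar>\<tau> x - (\<sigma> x)\<^sup>2 - E\<bar>) \<le> 1 + S + T + \<bar>E\<bar>" .
    note D = solutionsD[OF u]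
    show "first_order_system a (1 + S + T + \<bar>E\<bar>) \<sigma> (\<lambda>x. \<tau> x - (\<sigma> x)\<^sup>2 - E) u (quasi_deriv \<sigma> u)"
    proof
      show "1 \<le> 1 + S + T + \<bar>E\<bar>" using S T by simp
      show "continuous_on ?I u" "continuous_on ?I (quasi_deriv \<sigma> u)"
        using AC_loc_continuous_on D(1,2) a by auto
      show "integral ?I (\<lambda>x. (\<sigma> x)\<^sup>2) \<le> 1 + S + T + \<bar>E\<bar>" using \<sigma>2(2) T by simp
    qed (use \<sigma>1 \<sigma>2(1) q q' D(3,4) a in auto)
  qed
qed

section \<open>Measurability of solutions and comparison of weights\<close>

lemma borel_measurable_AC_loc:
  assumes "f \<in> AC_loc"
  shows "f \<in> borel_measurable (lebesgue_on {0<..})"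
proof (rule continuous_imp_measurable_on_sets_lebesgue)
  show "continuous_on {0<..} f"
    unfolding continuous_on_eq_continuous_at[OF open_greaterThan]
  proof
    fix x :: real assume "x \<in> {0<..}"
    then have "continuous_on {x/2..2*x} f" "x \<in> interior {x/2..2*x}"
      using AC_loc_continuous_on[OF assms, of "x/2" "2*x"] by (auto simp: interior_atLeastAtMost_real)
    then show "isCont f x" by (rule continuous_on_interior)
  qed
qed simp

lemma borel_measurable_norm_AC_loc:
  assumes "f \<in> AC_loc"
  shows "(\<lambda>x. norm (f x)) \<in> borel_measurable (lebesgue_on {0<..})"
  by (rule measurable_compose[OF borel_measurable_AC_loc[OF assms] borel_measurable_norm])

lemma weight_quotient_bound:
  fixes w :: "real \<Rightarrow> real"
  assumes pos: "\<forall>x>0. 0 < w x"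
    and sup: "(SUP (x, y)\<in>{(x, y). 0 < x \<and> 0 < y \<and> \<bar>x - y\<bar> \<le> 1}. ennreal (w y / w x)) < \<infinity>"
  obtains K where "0 < K" "\<And>x y. 0 < x \<Longrightarrow> 0 < y \<Longrightarrow> \<bar>x - y\<bar> \<le> 1 \<Longrightarrow> w y \<le> K * w x"
proof -
  define Q where "Q = (SUP (x, y)\<in>{(x, y). 0 < x \<and> 0 < y \<and> \<bar>x - y\<bar> \<le> 1}. ennreal (w y / w x))"
  have Q: "Q = ennreal (enn2real Q)" using sup by (simp add: Q_def)
  show ?thesis
  \<comment> \<open>Adding 1 makes positivity of the constant immediate.\<close>
  proof (rule that[of "enn2real Q + 1"])
    fix x y :: real assume xy: "0 < x" "0 < y" "\<bar>x - y\<bar> \<le> 1"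
    have "ennreal (w y / w x) \<le> Q"
      unfolding Q_def using xy by (intro SUP_upper2[of "(x, y)"]) auto
    then have "w y / w x \<le> enn2real Q"
      using Q by (metis enn2real_nonneg ennreal_le_iff)
    moreover have wx: "0 < w x" using pos xy(1) by blast
    ultimately have "w y \<le> enn2real Q * w x" by (simp add: pos_divide_le_eq)
    then show "w y \<le> (enn2real Q + 1) * w x" using wx by (simp add: algebra_simps)
  qed (simp add: add_nonneg_pos)
qed

lemma solutions_weighted_window_bound:
  fixes \<sigma> \<tau> w :: "real \<Rightarrow> real" and E :: real
  assumes "\<sigma> \<in> borel_measurable (lebesgue_on {0<..})"
    and "\<tau> \<in> borel_measurable (lebesgue_on {0<..})"
    and "(SUP x\<in>{0<..}. \<integral>\<^sup>+t\<in>{x..x+1}. ennreal ((\<sigma> t)\<^sup>2) \<partial>lebesgue) < \<infinity>"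
    and "(SUP x\<in>{0<..}. \<integral>\<^sup>+t\<in>{x..x+1}. ennreal \<bar>\<tau> t\<bar> \<partial>lebesgue) < \<infinity>"
    and w: "w \<in> borel_measurable (lebesgue_on {0<..})" and pos: "\<forall>x>0. w x > 0"
    and wsup: "(SUP (x, y)\<in>{(x, y). 0 < x \<and> 0 < y \<and> \<bar>x - y\<bar> \<le> 1}. ennreal (w y / w x)) < \<infinity>"
  obtains C where "0 < C" "\<And>u a x. u \<in> solutions \<sigma> \<tau> E \<Longrightarrow> 0 < a \<Longrightarrow> x \<in> {a..a+1} \<Longrightarrow>
    ennreal (w x * (norm (sol_vec \<sigma> u x))\<^sup>2)
      \<le> ennreal C * (\<integral>\<^sup>+t\<in>{a<..a+1}. ennreal (w t * (norm (u t))\<^sup>2) \<partial>lebesgue)"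
proof -
  obtain M where M: "1 \<le> M" "\<And>(a::real) u. 0 < a \<Longrightarrow> u \<in> solutions \<sigma> \<tau> E \<Longrightarrow>
      first_order_system a M \<sigma> (\<lambda>x. \<tau> x - (\<sigma> x)\<^sup>2 - E) u (quasi_deriv \<sigma> u)"
    by (rule solutions_first_order_system[OF assms(1-4), of E]) (rule that)
  obtain C where C: "0 < C" "\<And>a \<sigma> q u v x. first_order_system a M \<sigma> q u v \<Longrightarrow> x \<in> {a..a+1} \<Longrightarrow>
      (norm (u x))\<^sup>2 + (norm (v x))\<^sup>2 \<le> C * integral {a..a+1} (\<lambda>x. (norm (u x))\<^sup>2)"
    by (rule first_order_system_local_bound[OF M(1)]) (rule that)
  obtain K where K: "0 < K" "\<And>x y. 0 < x \<Longrightarrow> 0 < y \<Longrightarrow> \<bar>x - y\<bar> \<le> 1 \<Longrightarrow> w y \<le> K * w x"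
    by (rule weight_quotient_bound[OF pos wsup]) (rule that)
  show ?thesis
  proof (rule that[of "C * K"])
    show "0 < C * K" using C(1) K(1) by simp
    fix u and a x :: real assume u: "u \<in> solutions \<sigma> \<tau> E" and a: "0 < a" and x: "x \<in> {a..a+1}"
    have x0: "0 < x" using a x by simp
    have wx: "0 < w x" using pos x0 by blast
    have "continuous_on {a..a+1} u"
      using AC_loc_continuous_on[OF solutionsD(1)[OF u] a] .
    then have int: "(\<lambda>t. w x * (norm (u t))\<^sup>2) integrable_on {a..a+1}"
      by (intro integrable_continuous_real continuous_intros)
    have "w x * (norm (sol_vec \<sigma> u x))\<^sup>2 = w x * ((norm (u x))\<^sup>2 + (norm (quasi_deriv \<sigma> u x))\<^sup>2)"
      by (simp add: sol_vec_def norm_Pair)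
    also have "\<dots> \<le> w x * (C * integral {a..a+1} (\<lambda>t. (norm (u t))\<^sup>2))"
      using C(2)[OF M(2)[OF a u] x] wx by (intro mult_left_mono) simp_all
    also have "\<dots> = C * integral {a..a+1} (\<lambda>t. w x * (norm (u t))\<^sup>2)"
      by simp
    finally have le: "w x * (norm (sol_vec \<sigma> u x))\<^sup>2 \<le> C * integral {a..a+1} (\<lambda>t. w x * (norm (u t))\<^sup>2)" .
    have nonneg: "0 \<le> integral {a..a+1} (\<lambda>t. w x * (norm (u t))\<^sup>2)"
      using wx by (intro integral_nonneg[OF int]) simp
    have "ennreal (w x * (norm (sol_vec \<sigma> u x))\<^sup>2)
        \<le> ennreal C * ennreal (integral {a..a+1} (\<lambda>t. w x * (norm (u t))\<^sup>2))"
      using ennreal_leI[OF le] by (simp only: ennreal_mult[OF less_imp_le[OF C(1)] nonneg])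
    also have "ennreal (integral {a..a+1} (\<lambda>t. w x * (norm (u t))\<^sup>2))
        = (\<integral>\<^sup>+t\<in>{a<..a+1}. ennreal (w x * (norm (u t))\<^sup>2) \<partial>lebesgue)"
      using wx by (intro ennreal_integral_Ioc int) simp
    also have "\<dots> \<le> (\<integral>\<^sup>+t. ennreal K * (ennreal (w t * (norm (u t))\<^sup>2) * indicator {a<..a+1} t) \<partial>lebesgue)"
    proof (rule nn_integral_mono)
      fix t
      show "ennreal (w x * (norm (u t))\<^sup>2) * indicator {a<..a+1} t
          \<le> ennreal K * (ennreal (w t * (norm (u t))\<^sup>2) * indicator {a<..a+1} t)"
      proof (cases "t \<in> {a<..a+1}")
        case True
        then have t: "0 < t" "\<bar>t - x\<bar> \<le> 1" using a x by auto
        have "w x * (norm (u t))\<^sup>2 \<le> K * w t * (norm (u t))\<^sup>2"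
          by (rule mult_right_mono[OF K(2)[OF t(1) x0 t(2)]]) simp
        then have "ennreal (w x * (norm (u t))\<^sup>2) \<le> ennreal K * ennreal (w t * (norm (u t))\<^sup>2)"
          using K(1) pos t(1) by (subst ennreal_mult[symmetric]) (simp_all add: mult.assoc ennreal_leI less_imp_le)
        then show ?thesis using True by simp
      qed simp
    qed
    also have "\<dots> = ennreal K * (\<integral>\<^sup>+t\<in>{a<..a+1}. ennreal (w t * (norm (u t))\<^sup>2) \<partial>lebesgue)"
    proof (rule nn_integral_cmult)
      have "(\<lambda>t. w t * (norm (u t))\<^sup>2) \<in> borel_measurable (lebesgue_on {a<..a+1})"
        using a by (intro measurable_restrict_mono[OF borel_measurable_times[OF w borel_measurable_power[OF
          borel_measurable_norm_AC_loc[OF solutionsD(1)[OF u]]]]]) auto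
      then have "(\<lambda>t. ennreal (w t * (norm (u t))\<^sup>2)) \<in> borel_measurable (lebesgue_on {a<..a+1})"
        by (rule measurable_compose[OF _ measurable_ennreal])
      then show "(\<lambda>t. ennreal (w t * (norm (u t))\<^sup>2) * indicator {a<..a+1} t) \<in> borel_measurable lebesgue"
        by (subst (asm) borel_measurable_restrict_space_iff_ennreal) auto
    qed
    finally show "ennreal (w x * (norm (sol_vec \<sigma> u x))\<^sup>2)
        \<le> ennreal (C * K) * (\<integral>\<^sup>+t\<in>{a<..a+1}. ennreal (w t * (norm (u t))\<^sup>2) \<partial>lebesgue)"
      using C(1) K(1) by (simp add: ennreal_mult mult.assoc mult_left_mono)
  qed
qed

text \<open>One pointwise window bound yields all claims: summed over finitely many windows, summed
  over the half-line, and applied at the left end of a window moving to infinity.\<close>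

theorem theorem1p6:
  fixes \<sigma> \<tau> w :: "real \<Rightarrow> real" and E :: real
  assumes "\<sigma> \<in> borel_measurable (lebesgue_on {0<..})"
    and "\<tau> \<in> borel_measurable (lebesgue_on {0<..})"
    and "(SUP x\<in>{0<..}. \<integral>\<^sup>+t\<in>{x..x+1}. ennreal ((\<sigma> t)\<^sup>2) \<partial>lebesgue) < \<infinity>"
    and "(SUP x\<in>{0<..}. \<integral>\<^sup>+t\<in>{x..x+1}. ennreal \<bar>\<tau> t\<bar> \<partial>lebesgue) < \<infinity>"
    and "w \<in> borel_measurable (lebesgue_on {0<..})"
    and "\<forall>x>0. w x > 0"
    and "(SUP (x, y)\<in>{(x, y). 0 < x \<and> 0 < y \<and> \<bar>x - y\<bar> \<le> 1}. ennreal (w y / w x)) < \<infinity>"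
  shows "(\<exists>C::real. C > 0 \<and>
      (\<forall>l>1. \<forall>u\<in>solutions \<sigma> \<tau> E.
        (\<integral>\<^sup>+x\<in>{1..l}. ennreal (w x * (norm (sol_vec \<sigma> u x))\<^sup>2) \<partial>lebesgue)
          \<le> ennreal C * (\<integral>\<^sup>+x\<in>{0<..l+1}. ennreal (w x * (norm (u x))\<^sup>2) \<partial>lebesgue)))
    \<and> (\<forall>u\<in>solutions \<sigma> \<tau> E.
        (\<integral>\<^sup>+x\<in>{0<..}. ennreal (w x * (norm (u x))\<^sup>2) \<partial>lebesgue) < \<infinity> \<longrightarrow>
          (\<integral>\<^sup>+x\<in>{0<..}. ennreal (w x * (norm (quasi_deriv \<sigma> u x))\<^sup>2) \<partial>lebesgue) < \<infinity>
          \<and> ((\<lambda>x. sqrt (w x) * norm (u x)) \<longlongrightarrow> 0) at_top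
          \<and> ((\<lambda>x. sqrt (w x) * norm (quasi_deriv \<sigma> u x)) \<longlongrightarrow> 0) at_top)"
proof -
  have pos: "0 < w x" if "0 < x" for x using assms(6) that by blast
  obtain C where C: "0 < C" "\<And>u a x. u \<in> solutions \<sigma> \<tau> E \<Longrightarrow> 0 < a \<Longrightarrow> x \<in> {a..a+1} \<Longrightarrow>
      ennreal (w x * (norm (sol_vec \<sigma> u x))\<^sup>2)
        \<le> ennreal C * (\<integral>\<^sup>+t\<in>{a<..a+1}. ennreal (w t * (norm (u t))\<^sup>2) \<partial>lebesgue)"
    by (rule solutions_weighted_window_bound[OF assms, of E]) (rule that)
  \<comment> \<open>The functions are known to be measurable only on the half-line; the indicator
    extends them by 0 so that the summation lemmas on the whole line apply.\<close>
  let ?g = "\<lambda>u x. ennreal (w x * (norm (u x))\<^sup>2) * indicator {0<..} x"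
  let ?G = "\<lambda>u x. ennreal (w x * (norm (sol_vec \<sigma> u x))\<^sup>2) * indicator {0<..} x"
  have restr: "(\<integral>\<^sup>+x\<in>A. (f x * indicator {0<..} x) \<partial>lebesgue) = (\<integral>\<^sup>+x\<in>A. f x \<partial>lebesgue)"
    if "A \<subseteq> {0<..}" for A and f :: "real \<Rightarrow> ennreal"
    using that by (intro nn_integral_cong) (auto simp: indicator_def)
  have meas: "(\<lambda>x. ennreal (w x * (f x)\<^sup>2) * indicator {0<..} x) \<in> borel_measurable lebesgue"
    if "f \<in> borel_measurable (lebesgue_on {0<..})" for f
  proof -
    have "(\<lambda>x. ennreal (w x * (f x)\<^sup>2)) \<in> borel_measurable (lebesgue_on {0<..})"
      by (rule measurable_compose[OF borel_measurable_times[OF assms(5) borel_measurable_power[OF that]] measurable_ennreal])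
    then show ?thesis by (subst (asm) borel_measurable_restrict_space_iff_ennreal) auto
  qed
  have g: "?g u \<in> borel_measurable lebesgue" if u: "u \<in> solutions \<sigma> \<tau> E" for u
    by (rule meas[OF borel_measurable_norm_AC_loc[OF solutionsD(1)[OF u]]])
  have G: "?G u \<in> borel_measurable lebesgue" if u: "u \<in> solutions \<sigma> \<tau> E" for u
  proof (rule meas)
    have "(\<lambda>x. sqrt ((norm (quasi_deriv \<sigma> u x))\<^sup>2 + (norm (u x))\<^sup>2)) \<in> borel_measurable (lebesgue_on {0<..})"
      by (intro measurable_compose[OF _ borel_measurable_sqrt] borel_measurable_add borel_measurable_power
        borel_measurable_norm_AC_loc solutionsD[OF u])
    then show "(\<lambda>x. norm (sol_vec \<sigma> u x)) \<in> borel_measurable (lebesgue_on {0<..})"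
      by (simp add: sol_vec_def norm_Pair)
  qed
  have window: "?G u x \<le> ennreal C * (\<integral>\<^sup>+t\<in>{a<..a+1}. ?g u t \<partial>lebesgue)"
    if "u \<in> solutions \<sigma> \<tau> E" "0 < a" "x \<in> {a<..a+1}" for u a x
    using C(2)[OF that(1,2), of x] that by (subst restr) auto
  have first: "(\<integral>\<^sup>+x\<in>{1..l}. ennreal (w x * (norm (sol_vec \<sigma> u x))\<^sup>2) \<partial>lebesgue)
      \<le> ennreal C * (\<integral>\<^sup>+x\<in>{0<..l+1}. ennreal (w x * (norm (u x))\<^sup>2) \<partial>lebesgue)"
    if l: "1 < l" and u: "u \<in> solutions \<sigma> \<tau> E" for l u
  proof -
    \<comment> \<open>Windows starting at 1/2 keep the left end positive and below 1; the smallest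
      number of them that reaches \<open>l\<close> ends before \<open>l + 1\<close>.\<close>
    define n where "n = nat \<lceil>l - 1/2\<rceil>"
    have n: "l \<le> 1/2 + real n" "1/2 + real n \<le> l + 1"
      using l unfolding n_def by linarith+
    have "(\<integral>\<^sup>+x\<in>{1..l}. ennreal (w x * (norm (sol_vec \<sigma> u x))\<^sup>2) \<partial>lebesgue)
        \<le> (\<integral>\<^sup>+x\<in>{1/2<..1/2+real n}. ?G u x \<partial>lebesgue)"
      using n by (intro nn_integral_mono) (auto simp: indicator_def)
    also have "\<dots> \<le> ennreal C * (\<integral>\<^sup>+x\<in>{1/2<..1/2+real n}. ?g u x \<partial>lebesgue)"
      by (rule set_nn_integral_windows_le[OF g[OF u] G[OF u] window[OF u]]) simp_all
    also have "\<dots> \<le> ennreal C * (\<integral>\<^sup>+x\<in>{0<..l+1}. ennreal (w x * (norm (u x))\<^sup>2) \<partial>lebesgue)"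
      using n by (intro mult_left_mono nn_integral_mono) (auto simp: indicator_def)
    finally show ?thesis .
  qed
  have second: "(\<integral>\<^sup>+x\<in>{0<..}. ennreal (w x * (norm (quasi_deriv \<sigma> u x))\<^sup>2) \<partial>lebesgue) < \<infinity>
      \<and> ((\<lambda>x. sqrt (w x) * norm (u x)) \<longlongrightarrow> 0) at_top
      \<and> ((\<lambda>x. sqrt (w x) * norm (quasi_deriv \<sigma> u x)) \<longlongrightarrow> 0) at_top"
    if u: "u \<in> solutions \<sigma> \<tau> E"
      and fin: "(\<integral>\<^sup>+x\<in>{0<..}. ennreal (w x * (norm (u x))\<^sup>2) \<partial>lebesgue) < \<infinity>" for u
  proof (intro conjI)
    have le: "norm (u x) \<le> norm (sol_vec \<sigma> u x)" "norm (quasi_deriv \<sigma> u x) \<le> norm (sol_vec \<sigma> u x)" for x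
      by (simp_all add: sol_vec_def norm_Pair real_le_rsqrt)
    have fin': "(\<integral>\<^sup>+x\<in>{0<..}. ?g u x \<partial>lebesgue) < \<infinity>"
      using fin by (simp add: restr)
    have "(\<integral>\<^sup>+x\<in>{0<..}. ennreal (w x * (norm (quasi_deriv \<sigma> u x))\<^sup>2) \<partial>lebesgue)
        \<le> (\<integral>\<^sup>+x\<in>{0<..}. ?G u x \<partial>lebesgue)"
    proof (rule nn_integral_mono)
      fix x
      show "ennreal (w x * (norm (quasi_deriv \<sigma> u x))\<^sup>2) * indicator {0<..} x \<le> ?G u x * indicator {0<..} x"
      proof (cases "0 < x")
        case True
        have "w x * (norm (quasi_deriv \<sigma> u x))\<^sup>2 \<le> w x * (norm (sol_vec \<sigma> u x))\<^sup>2"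
          using le(2)[of x] pos[OF True] by (intro mult_left_mono power_mono) simp_all
        then show ?thesis using True by (simp add: ennreal_leI)
      qed simp
    qed
    also have "\<dots> \<le> ennreal C * (\<integral>\<^sup>+x\<in>{0<..}. ?g u x \<partial>lebesgue)"
      by (rule set_nn_integral_half_line_le[OF g[OF u] G[OF u] window[OF u]]) simp_all
    also have "\<dots> < \<infinity>"
      using fin' by (simp add: ennreal_mult_less_top)
    finally show "(\<integral>\<^sup>+x\<in>{0<..}. ennreal (w x * (norm (quasi_deriv \<sigma> u x))\<^sup>2) \<partial>lebesgue) < \<infinity>" .

    \<comment> \<open>The window starts at \<open>x\<close> itself, so \<open>b\<close> controls the
      solution at \<open>x\<close> and tends to 0 with the window integral.\<close>
    define b where "b x = ennreal C * (\<integral>\<^sup>+t\<in>{x<..x+1}. ?g u t \<partial>lebesgue)" for x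
    have "(b \<longlongrightarrow> ennreal C * 0) at_top"
      unfolding b_def by (intro tendsto_mult_ennreal tendsto_const set_nn_integral_window_tendsto_0[OF g[OF u] fin']) simp
    then have b: "(b \<longlongrightarrow> 0) at_top" by simp
    have bound: "ennreal (w x * (norm (sol_vec \<sigma> u x))\<^sup>2) \<le> b x" if "0 < x" for x
      using C(2)[OF u that, of x] that unfolding b_def by (subst restr) auto
    have sq: "((\<lambda>x. w x * (norm (sol_vec \<sigma> u x))\<^sup>2) \<longlongrightarrow> 0) at_top"
    proof (rule order_tendstoI)
      fix e :: real assume e: "e < 0"
      show "eventually (\<lambda>x. e < w x * (norm (sol_vec \<sigma> u x))\<^sup>2) at_top"
        using eventually_gt_at_top[of 0]
      proof eventually_elim
        fix x :: real assume "0 < x"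
        then have "0 \<le> w x * (norm (sol_vec \<sigma> u x))\<^sup>2" using pos[of x] by simp
        with e show "e < w x * (norm (sol_vec \<sigma> u x))\<^sup>2" by linarith
      qed
    next
      fix e :: real assume "0 < e"
      then have "eventually (\<lambda>x. b x < ennreal e) at_top"
        by (intro order_tendstoD[OF b]) simp
      then show "eventually (\<lambda>x. w x * (norm (sol_vec \<sigma> u x))\<^sup>2 < e) at_top"
        using eventually_gt_at_top[of 0]
      proof eventually_elim
        fix x :: real assume "b x < ennreal e" "0 < x"
        then have "ennreal (w x * (norm (sol_vec \<sigma> u x))\<^sup>2) < ennreal e"
          using bound order_le_less_trans by blast
        then show "w x * (norm (sol_vec \<sigma> u x))\<^sup>2 < e"
          using pos[OF \<open>0 < x\<close>] by (subst (asm) ennreal_less_iff) simp_all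
      qed
    qed
    have lim: "((\<lambda>x. sqrt (w x) * norm (sol_vec \<sigma> u x)) \<longlongrightarrow> 0) at_top"
      using tendsto_real_sqrt[OF sq] by (simp add: real_sqrt_mult)
    \<comment> \<open>Both components are dominated by the norm of the pair, so one squeeze argument
      serves the two limits.\<close>
    have dom: "((\<lambda>x. sqrt (w x) * f x) \<longlongrightarrow> 0) at_top"
      if f: "\<And>x. 0 \<le> f x" "\<And>x. f x \<le> norm (sol_vec \<sigma> u x)" for f
    proof (rule tendsto_sandwich[OF _ _ tendsto_const lim])
      show "eventually (\<lambda>x. 0 \<le> sqrt (w x) * f x) at_top"
        using eventually_gt_at_top[of 0]
        by eventually_elim (use pos f(1) in \<open>simp add: less_imp_le\<close>)
      show "eventually (\<lambda>x. sqrt (w x) * f x \<le> sqrt (w x) * norm (sol_vec \<sigma> u x)) at_top"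
        using eventually_gt_at_top[of 0]
        by eventually_elim (use pos in \<open>auto intro!: mult_left_mono f(2) simp: less_imp_le\<close>)
    qed
    show "((\<lambda>x. sqrt (w x) * norm (u x)) \<longlongrightarrow> 0) at_top"
      by (rule dom) (simp_all add: le)
    show "((\<lambda>x. sqrt (w x) * norm (quasi_deriv \<sigma> u x)) \<longlongrightarrow> 0) at_top"
      by (rule dom) (simp_all add: le)
  qed
  show ?thesis using C(1) first second by blast
qed

end
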